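(* Let $X$ be a non-negative absolutely continuous random variable with probability density function $f$, and let $X_1,X_2,\ldots$ be i.i.d. copies of $X$. For each $n$ let $X_{(1)}\le\cdots\le X_{(n)}$ be the order statistics of $X_1,\ldots,X_n$, and let $m=m(n)$ be an integer with $1\le m\le n$. If $f$ is bounded, then $$VJV_{m,n}\to VJ(X)\quad\text{almost surely},$$ provided $m,n\to\infty$, $\frac{m}{\log n}\to\infty$ and $\frac{m}{n}\to 0$.
   Context: The varextropy of a non-negative absolutely continuous random variable $X$ with density $f$ is $$VJ(X)=\mathrm{Var}\left[-\tfrac12 f(X)\right]=\tfrac14 E[f^2(X)]-J^2(X)=\tfrac14\left[\int_0^{\infty}f^3(x)\,dx-\left(\int_0^\infty f^2(x)\,dx\right)^2\right],\qquad J(X)=-\tfrac12\int_0^\infty f^2(x)\,dx .$$ The estimator is $$VJV_{m,n}=\tfrac14\left\{T'_{m,n}-(T''_{m,n})^2\right\},$$ where $$T'_{m,n}=\frac1{n-m}\sum_{j=1}^{n-m}\left(\frac{m}{n+1}\,(X_{(j+m)}-X_{(j)})^{-1}\right)^2,\qquad T''_{m,n}=\frac1{n-m}\sum_{j=1}^{n-m}\frac{m}{n+1}\,(X_{(j+m)}-X_{(j)})^{-1}.$$ *)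

theory Defs
  imports "HOL-Probability.Probability"
begin

text \<open>\<open>f\<close> is a density of \<open>X\<close>. It is an explicit argument; the value does not depend on which
  version of the density is chosen.\<close>

definition varextropy :: "'a measure \<Rightarrow> ('a \<Rightarrow> real) \<Rightarrow> (real \<Rightarrow> real) \<Rightarrow> real" where
  "varextropy M X f = prob_space.variance M (\<lambda>\<omega>. - (1 / 2) * f (X \<omega>))"

text \<open>The sample of size \<open>n\<close> is \<open>x 1, \<dots>, x n\<close>, and \<open>order_stat n x k\<close> is its \<open>k\<close>-th smallest
  value, counted with multiplicity; it is meaningful for \<open>1 \<le> k \<le> n\<close>.\<close>

definition order_stat :: "nat \<Rightarrow> (nat \<Rightarrow> real) \<Rightarrow> nat \<Rightarrow> real" where
  "order_stat n x k = sort (map x [1..<n + 1]) ! (k - 1)"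

definition spacing_density :: "nat \<Rightarrow> nat \<Rightarrow> (nat \<Rightarrow> real) \<Rightarrow> nat \<Rightarrow> real" where
  "spacing_density m n x j =
     real m / (real n + 1) * inverse (order_stat n x (j + m) - order_stat n x j)"

definition T1 :: "nat \<Rightarrow> nat \<Rightarrow> (nat \<Rightarrow> real) \<Rightarrow> real" where
  "T1 m n x = 1 / real (n - m) * (\<Sum>j = 1..n - m. (spacing_density m n x j)\<^sup>2)"

definition T2 :: "nat \<Rightarrow> nat \<Rightarrow> (nat \<Rightarrow> real) \<Rightarrow> real" where
  "T2 m n x = 1 / real (n - m) * (\<Sum>j = 1..n - m. spacing_density m n x j)"

definition VJV :: "nat \<Rightarrow> nat \<Rightarrow> (nat \<Rightarrow> real) \<Rightarrow> real" where
  "VJV m n x = 1 / 4 * (T1 m n x - (T2 m n x)\<^sup>2)"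

end

theory Submission
  imports Defs
begin

text \<open>Write \<open>x j\<close> for the \<open>j\<close>-th order statistic, \<open>F\<close> for the distribution function, and
\<open>s j\<close> for \<open>m / ((n + 1) (x (j + m) - x j))\<close>. The estimator is built from the means of
\<open>s j\<close> and \<open>(s j)\<^sup>2\<close>. It is shown that almost surely the mean of \<open>\<bar>s j - f (x j)\<bar>\<close>
over \<open>j\<close> tends to \<open>0\<close>. These quantities are bounded for large \<open>n\<close>, so \<open>s j\<close> may then be replaced
by \<open>f (x j)\<close> in both means. A sum over the order statistics is a sum over the sample, and the
strong law of large numbers gives the limits \<open>E[f(X)]\<close> and \<open>E[f(X)\<^sup>2]\<close>.

The first ingredient is that spacings have the right mass: almost surely
\<open>F (x (j + m)) - F (x j) = (m / n) (1 + o(1))\<close> uniformly in \<open>j\<close>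
(\<open>AE_uniform_cdf_spacing\<close>). As \<open>F(X)\<close> is uniform, this is a statement about the numbers of
uniform sample points in the intervals with endpoints on a grid of mesh \<open>1 / n\<close>. A Chernoff bound
(\<open>deviation_bound\<close>) controls each number up to an error \<open>\<epsilon> (expected number + m)\<close> with
probability \<open>1 - 2 exp (- \<epsilon>\<^sup>2 m)\<close>; since \<open>m / log n\<close> tends to infinity, this beats the
number of intervals, of order \<open>n\<^sup>2\<close>, and the Borel-Cantelli lemma applies. Hence \<open>s j\<close>
is, up to a factor \<open>1 + o(1)\<close>, the average of \<open>f\<close> over \<open>{x j<..x (j + m)}\<close>.

The second ingredient compares this average with \<open>f (x j)\<close>. For a continuous \<open>\<phi>\<close> of compact
support in place of \<open>f\<close>, uniform continuity suffices on short spacings, and long spacings meeting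
the support are few, because every point lies in at most \<open>m\<close> spacings and \<open>m / n\<close> tends to
\<open>0\<close>. A general \<open>f\<close> is approximated by \<open>\<phi>\<close> in \<open>L\<^sup>1\<close>. The error at the points
\<open>x j\<close> is controlled by the strong law for \<open>\<bar>f - \<phi>\<bar>\<close>. The error of the averages is at
most \<open>2 B n / m\<close> times the integral over the spacing, where \<open>B\<close> bounds \<open>f\<close>, and these
integrals sum to at most \<open>m\<close> times the norm of \<open>f - \<phi>\<close>, again by the bounded overlap
(\<open>sum_integrals_over_spacings\<close>).\<close>

section \<open>Concentration for empirical sums\<close>

lemma exp_le_quadratic:
  fixes y :: real
  assumes "\<bar>y\<bar> \<le> 1"
  shows "exp y \<le> 1 + y + y\<^sup>2"
proof (cases "0 \<le> y")
  case True
  then show ?thesis using exp_bound assms by auto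
next
  case False
  define z where "z = - y"
  have z: "0 < z" "z \<le> 1" using False assms by (auto simp: z_def)
  have "1 \<le> (1 - z + z\<^sup>2) * (1 + z)"
    using z by (simp add: algebra_simps power2_eq_square)
  also have "\<dots> \<le> (1 - z + z\<^sup>2) * exp z"
    using z exp_ge_add_one_self[of z] by (intro mult_left_mono) auto
  finally have "exp (- z) \<le> 1 - z + z\<^sup>2"
    by (simp add: exp_minus field_simps)
  then show ?thesis by (simp add: z_def)
qed

locale iid_sample = prob_space M for M :: "'a measure" +
  fixes Xs :: "nat \<Rightarrow> 'a \<Rightarrow> real" and D :: "real measure"
  assumes indep: "indep_vars (\<lambda>_. borel) Xs {1..}"
    and distr_Xs: "\<And>i. 1 \<le> i \<Longrightarrow> distr M borel (Xs i) = D"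
begin

lemma Xs_measurable [measurable]: "1 \<le> i \<Longrightarrow> Xs i \<in> borel_measurable M"
  using indep by (auto simp: indep_vars_def)

lemma sets_D [measurable_cong, simp]: "sets D = sets borel"
  using distr_Xs[of 1] by (metis order_refl sets_distr)

lemma prob_space_D: "prob_space D"
  using distr_Xs[of 1] prob_space_distr[of "Xs 1" borel] by simp

lemma expectation_comp:
  fixes h :: "real \<Rightarrow> real"
  assumes [measurable]: "h \<in> borel_measurable borel" and "1 \<le> i"
  shows "expectation (\<lambda>\<omega>. h (Xs i \<omega>)) = (\<integral>x. h x \<partial>D)"
  using integral_distr[of "Xs i" M borel h] assms Xs_measurable[of i] distr_Xs[of i] by simp

lemma integrable_D_bounded:
  fixes h :: "real \<Rightarrow> real"
  assumes [measurable]: "h \<in> borel_measurable borel" and "\<And>x. \<bar>h x\<bar> \<le> B"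
  shows "integrable D h"
proof -
  interpret D: prob_space D by (rule prob_space_D)
  show ?thesis using assms by (intro D.integrable_const_bound[where B = B]) auto
qed

text \<open>Chernoff's method. Since \<open>h\<close> takes values in the unit interval, \<open>h\<^sup>2 \<le> h\<close>, so the
quadratic bound on the exponential makes the moment generating function of one summand at
\<open>l\<close> at most \<open>1 + (l + l\<^sup>2) p\<close> with \<open>p\<close> the mean of \<open>h\<close>. The variance
thus enters only through \<open>p\<close>, which is what makes the bound sharp for rare events;
Hoeffding's inequality would lose this.\<close>

lemma chernoff:
  fixes h :: "real \<Rightarrow> real" and l c :: real
  assumes h[measurable]: "h \<in> borel_measurable borel"
    and h01: "\<And>x. 0 \<le> h x" "\<And>x. h x \<le> 1" and l: "\<bar>l\<bar> \<le> 1"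
  shows "prob {\<omega> \<in> space M. c \<le> l * (\<Sum>i=1..n. h (Xs i \<omega>))}
    \<le> exp (real n * (\<integral>x. h x \<partial>D) * (l + l\<^sup>2) - c)"
proof -
  let ?p = "\<integral>x. h x \<partial>D"
  have pt: "exp (l * h x) \<le> 1 + (l + l\<^sup>2) * h x" for x
  proof -
    have "\<bar>l * h x\<bar> \<le> 1 * 1" unfolding abs_mult using l h01[of x] by (intro mult_mono) auto
    then have "exp (l * h x) \<le> 1 + l * h x + (l * h x)\<^sup>2" by (intro exp_le_quadratic) simp
    also have "(l * h x)\<^sup>2 = l\<^sup>2 * (h x * h x)" by (simp add: power2_eq_square)
    also have "\<dots> \<le> l\<^sup>2 * (h x * 1)" using h01[of x] by (intro mult_left_mono) auto
    finally show ?thesis by (simp add: algebra_simps)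
  qed
  have ub: "\<bar>exp (l * h x)\<bar> \<le> exp 1" for x
  proof -
    have "\<bar>l * h x\<bar> \<le> 1 * 1" unfolding abs_mult using l h01[of x] by (intro mult_mono) auto
    then show ?thesis by auto
  qed
  interpret D: prob_space D by (rule prob_space_D)
  have ih: "integrable D h" by (rule integrable_D_bounded[where B=1]) (use h01 in auto)
  have mgf: "(\<integral>x. exp (l * h x) \<partial>D) \<le> exp (?p * (l + l\<^sup>2))"
  proof -
    have "(\<integral>x. exp (l * h x) \<partial>D) \<le> (\<integral>x. 1 + (l + l\<^sup>2) * h x \<partial>D)"
    proof (rule integral_mono)
      show "integrable D (\<lambda>x. exp (l * h x))" by (rule integrable_D_bounded[OF _ ub]) simp
      show "integrable D (\<lambda>x. 1 + (l + l\<^sup>2) * h x)" using ih by simp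
    qed (rule pt)
    also have "\<dots> = 1 + (l + l\<^sup>2) * ?p" using ih D.prob_space by simp
    also have "\<dots> \<le> exp ((l + l\<^sup>2) * ?p)" by (rule exp_ge_add_one_self)
    finally show ?thesis by (simp add: mult.commute)
  qed
  have ind: "indep_vars (\<lambda>_. borel) (\<lambda>i \<omega>. exp (l * h (Xs i \<omega>))) {1..n}"
    by (rule indep_vars_compose2[where Y="\<lambda>_ x. exp (l * h x)" and M'="\<lambda>_. borel"])
       (auto intro: indep_vars_subset[OF indep])
  have int1: "integrable M (\<lambda>\<omega>. exp (l * h (Xs i \<omega>)))" if "i \<in> {1..n}" for i
    using ub that by (intro integrable_const_bound[where B="exp 1"]) auto
  have eS: "exp (l * (\<Sum>i=1..n. h (Xs i \<omega>))) = (\<Prod>i=1..n. exp (l * h (Xs i \<omega>)))" for \<omega>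
    by (simp add: sum_distrib_left exp_sum)
  have intS: "integrable M (\<lambda>\<omega>. exp (l * (\<Sum>i=1..n. h (Xs i \<omega>))))"
    unfolding eS by (rule indep_vars_integrable[OF _ ind int1]) auto
  have "expectation (\<lambda>\<omega>. exp (l * (\<Sum>i=1..n. h (Xs i \<omega>)))) =
      (\<Prod>i=1..n. expectation (\<lambda>\<omega>. exp (l * h (Xs i \<omega>))))"
    unfolding eS by (rule indep_vars_lebesgue_integral[OF _ ind int1]) auto
  also have "\<dots> = (\<Prod>i=1..n. (\<integral>x. exp (l * h x) \<partial>D))"
    by (intro prod.cong refl expectation_comp) auto
  also have "\<dots> \<le> exp (?p * (l + l\<^sup>2)) ^ n"
    using mgf by (simp add: power_mono)
  finally have E: "expectation (\<lambda>\<omega>. exp (l * (\<Sum>i=1..n. h (Xs i \<omega>)))) \<le> exp (real n * ?p * (l + l\<^sup>2))"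
    by (simp add: exp_of_nat_mult[symmetric] mult.assoc)
  have "prob {\<omega> \<in> space M. c \<le> l * (\<Sum>i=1..n. h (Xs i \<omega>))}
      = prob {\<omega> \<in> space M. exp c \<le> exp (l * (\<Sum>i=1..n. h (Xs i \<omega>)))}" by simp
  also have "\<dots> \<le> expectation (\<lambda>\<omega>. exp (l * (\<Sum>i=1..n. h (Xs i \<omega>)))) / exp c"
    by (rule integral_Markov_inequality_measure[OF intS, of "{}"]) auto
  also have "\<dots> \<le> exp (real n * ?p * (l + l\<^sup>2)) / exp c"
    using E by (intro divide_right_mono) auto
  finally show ?thesis by (simp add: exp_diff)
qed

text \<open>The error \<open>\<epsilon> (n p + t)\<close> has a part proportional to the mean and a part proportional to a
free scale \<open>t\<close>. With \<open>l = \<plusminus> \<epsilon>\<close> in Chernoff's bound the terms containing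
\<open>n p\<close> cancel exactly, so that the probability does not depend on \<open>p\<close>, and one bound serves
intervals of every mass.\<close>

lemma deviation_bound:
  fixes h :: "real \<Rightarrow> real" and \<epsilon> t :: real
  assumes h[measurable]: "h \<in> borel_measurable borel"
    and h01: "\<And>x. 0 \<le> h x" "\<And>x. h x \<le> 1" and \<epsilon>: "0 < \<epsilon>" "\<epsilon> \<le> 1"
  shows "prob {\<omega> \<in> space M. \<epsilon> * (real n * (\<integral>x. h x \<partial>D) + t)
      \<le> \<bar>(\<Sum>i=1..n. h (Xs i \<omega>)) - real n * (\<integral>x. h x \<partial>D)\<bar>} \<le> 2 * exp (- \<epsilon>\<^sup>2 * t)"
    (is "prob ?E \<le> _")
proof -
  define q where "q = real n * (\<integral>x. h x \<partial>D)"
  define S where "S \<omega> = (\<Sum>i=1..n. h (Xs i \<omega>))" for \<omega>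
  have [measurable]: "S \<in> borel_measurable M" unfolding S_def by (intro borel_measurable_sum) auto
  \<comment> \<open>the deviation event, multiplied by \<open>\<epsilon>\<close> and split by the sign of the deviation\<close>
  let ?A = "\<lambda>l. {\<omega> \<in> space M. l * q + \<epsilon>\<^sup>2 * (q + t) \<le> l * S \<omega>}"
  have A: "prob (?A l) \<le> exp (- \<epsilon>\<^sup>2 * t)" if "\<bar>l\<bar> = \<epsilon>" for l
  proof -
    have "l\<^sup>2 = \<epsilon>\<^sup>2" using that by (metis power2_abs)
    then show ?thesis
      using chernoff[OF h h01, of l "l * q + \<epsilon>\<^sup>2 * (q + t)" n] that \<epsilon>
      unfolding S_def[symmetric] q_def[symmetric] by (simp add: algebra_simps)
  qed
  have "?E \<subseteq> ?A \<epsilon> \<union> ?A (- \<epsilon>)"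
  proof
    fix \<omega> assume w: "\<omega> \<in> ?E"
    then have "\<epsilon> * (\<epsilon> * (q + t)) \<le> \<epsilon> * \<bar>S \<omega> - q\<bar>"
      using \<epsilon> by (intro mult_left_mono) (auto simp: q_def S_def)
    with w show "\<omega> \<in> ?A \<epsilon> \<union> ?A (- \<epsilon>)"
      by (cases "0 \<le> S \<omega> - q") (auto simp: algebra_simps power2_eq_square)
  qed
  then have "prob ?E \<le> prob (?A \<epsilon> \<union> ?A (- \<epsilon>))" by (intro finite_measure_mono) auto
  also have "\<dots> \<le> prob (?A \<epsilon>) + prob (?A (- \<epsilon>))" by (intro measure_Un_le) auto
  also have "\<dots> \<le> 2 * exp (- \<epsilon>\<^sup>2 * t)" using A[of \<epsilon>] A[of "- \<epsilon>"] \<epsilon> by simp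
  finally show ?thesis .
qed

text \<open>A growth of \<open>t\<close> faster than the logarithm turns \<open>exp (- \<epsilon>\<^sup>2 * t n)\<close> into something smaller
than any power of \<open>n\<close>. A union bound over polynomially many functions is therefore still
summable, and the Borel-Cantelli lemma applies. For \<open>t = m\<close> this is where the condition on
\<open>m / log n\<close> enters.\<close>

lemma AE_eventually_uniform_deviation:
  fixes t :: "nat \<Rightarrow> real" and H :: "nat \<Rightarrow> (real \<Rightarrow> real) set"
  assumes t: "filterlim (\<lambda>n. t n / ln (real n)) at_top sequentially"
    and H: "\<And>n. finite (H n)" "\<And>n. 1 \<le> n \<Longrightarrow> real (card (H n)) \<le> a * (real n)\<^sup>2"
    and Hm: "\<And>n h. h \<in> H n \<Longrightarrow> h \<in> borel_measurable borel"
    and H01: "\<And>n h x. h \<in> H n \<Longrightarrow> 0 \<le> h x" "\<And>n h x. h \<in> H n \<Longrightarrow> h x \<le> 1"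
  shows "AE \<omega> in M. \<forall>\<epsilon>>0. \<forall>\<^sub>F n in sequentially. \<forall>h\<in>H n.
    \<bar>(\<Sum>i=1..n. h (Xs i \<omega>)) - real n * (\<integral>x. h x \<partial>D)\<bar> \<le> \<epsilon> * (real n * (\<integral>x. h x \<partial>D) + t n)"
proof -
  let ?P = "\<lambda>\<epsilon> \<omega> n h. \<bar>(\<Sum>i=1..n. h (Xs i \<omega>)) - real n * (\<integral>x. h x \<partial>D)\<bar>
      \<le> \<epsilon> * (real n * (\<integral>x. h x \<partial>D) + t n)"
  have one: "AE \<omega> in M. \<forall>\<^sub>F n in sequentially. \<forall>h\<in>H n. ?P \<epsilon> \<omega> n h"
    if \<epsilon>: "0 < \<epsilon>" "\<epsilon> \<le> 1" for \<epsilon>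
  proof -
    define E where "E n h = {\<omega> \<in> space M. \<epsilon> * (real n * (\<integral>x. h x \<partial>D) + t n)
      \<le> \<bar>(\<Sum>i=1..n. h (Xs i \<omega>)) - real n * (\<integral>x. h x \<partial>D)\<bar>}" for n h
    define A where "A n = (\<Union>h\<in>H n. E n h)" for n
    have Em: "E n h \<in> sets M" if "h \<in> H n" for n h
    proof -
      have [measurable]: "h \<in> borel_measurable borel" using Hm that .
      have [measurable]: "(\<lambda>\<omega>. \<Sum>i=1..n. h (Xs i \<omega>)) \<in> borel_measurable M"
        by (intro borel_measurable_sum) auto
      show ?thesis unfolding E_def by simp
    qed
    have Am: "A n \<in> sets M" for n unfolding A_def using H Em by auto
    have PA: "prob (A n) \<le> real (card (H n)) * (2 * exp (- \<epsilon>\<^sup>2 * t n))" for n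
    proof -
      have "prob (A n) \<le> (\<Sum>h\<in>H n. prob (E n h))"
        unfolding A_def by (rule measure_UNION_le) (use H Em in auto)
      also have "\<dots> \<le> (\<Sum>h\<in>H n. 2 * exp (- \<epsilon>\<^sup>2 * t n))"
        unfolding E_def by (intro sum_mono deviation_bound Hm H01 \<epsilon>)
      finally show ?thesis by simp
    qed
    have ev: "\<forall>\<^sub>F n in sequentially. norm (prob (A n)) \<le> 2 * a * inverse ((real n)\<^sup>2)"
      using filterlim_at_top[THEN iffD1, OF t, rule_format, of "4 / \<epsilon>\<^sup>2"] eventually_gt_at_top[of 1]
    proof eventually_elim
      case (elim n)
      then have ln: "0 < ln (real n)" by simp
      \<comment> \<open>the exponent 4 beats the \<open>n\<^sup>2\<close> functions and leaves a summable \<open>1 / n\<^sup>2\<close>\<close>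
      then have "4 * ln (real n) \<le> \<epsilon>\<^sup>2 * t n"
        using elim \<epsilon> by (simp add: field_simps)
      then have "exp (- \<epsilon>\<^sup>2 * t n) \<le> exp (- (4 * ln (real n)))" by simp
      also have "\<dots> = inverse ((real n) ^ 4)"
        using elim exp_of_nat_mult[of 4 "ln (real n)"] by (simp add: exp_minus)
      finally have e4: "exp (- \<epsilon>\<^sup>2 * t n) \<le> inverse ((real n) ^ 4)" .
      have "prob (A n) \<le> real (card (H n)) * (2 * exp (- \<epsilon>\<^sup>2 * t n))" by (rule PA)
      also have "\<dots> \<le> (a * (real n)\<^sup>2) * (2 * inverse ((real n) ^ 4))"
        using elim H(2)[of n] e4 order_trans[OF of_nat_0_le_iff H(2)[of n]] by (intro mult_mono) auto
      also have "\<dots> = 2 * a * inverse ((real n)\<^sup>2)"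
        using elim by (simp add: field_simps power2_eq_square eval_nat_numeral)
      finally show ?case by simp
    qed
    have "summable (\<lambda>n. prob (A n))"
      by (rule summable_comparison_test_ev[OF ev]) (intro summable_mult inverse_power_summable, simp)
    from borel_cantelli_AE1[OF Am _ this]
    have "AE \<omega> in M. \<forall>\<^sub>F n in sequentially. \<omega> \<in> space M - A n" by (simp add: less_top[symmetric])
    then show ?thesis
    proof eventually_elim
      case (elim \<omega>)
      then show ?case
        by eventually_elim (auto simp: A_def E_def not_le intro: less_imp_le)
    qed
  qed
  have "AE \<omega> in M. \<forall>k::nat. \<forall>\<^sub>F n in sequentially. \<forall>h\<in>H n. ?P (1 / real (Suc k)) \<omega> n h"
    unfolding AE_all_countable by (intro allI one) auto
  then show ?thesis
  proof eventually_elim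
    case (elim \<omega>)
    show ?case
    proof (intro allI impI)
      fix \<epsilon> :: real assume "0 < \<epsilon>"
      then obtain k where k: "1 / real (Suc k) < \<epsilon>" using nat_approx_posE by blast
      have tp: "\<forall>\<^sub>F n in sequentially. 0 \<le> t n"
        using filterlim_at_top[THEN iffD1, OF t, rule_format, of 0] eventually_gt_at_top[of 1]
        by eventually_elim (auto simp: zero_le_divide_iff)
      show "\<forall>\<^sub>F n in sequentially. \<forall>h\<in>H n. ?P \<epsilon> \<omega> n h"
        using elim[rule_format, of k] tp
      proof eventually_elim
        case (elim n)
        show ?case
        proof
          fix h assume h: "h \<in> H n"
          have "0 \<le> real n * (\<integral>x. h x \<partial>D)" using H01(1)[OF h] by (simp add: integral_nonneg_AE)
          then have "1 / real (Suc k) * (real n * (\<integral>x. h x \<partial>D) + t n) \<le> \<epsilon> * (real n * (\<integral>x. h x \<partial>D) + t n)"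
            using elim k by (intro mult_right_mono) auto
          then show "?P \<epsilon> \<omega> n h" using elim h by fastforce
        qed
      qed
    qed
  qed
qed

text \<open>The case of a single function and of the scale \<open>t n = n\<close>, where the error is a small multiple
of \<open>n\<close>.\<close>

lemma strong_law_bounded:
  fixes h :: "real \<Rightarrow> real"
  assumes [measurable]: "h \<in> borel_measurable borel" and h: "\<And>x. 0 \<le> h x" "\<And>x. h x \<le> B"
  shows "AE \<omega> in M. (\<lambda>n. (\<Sum>i=1..n. h (Xs i \<omega>)) / real n) \<longlonglongrightarrow> (\<integral>x. h x \<partial>D)"
proof -
  interpret D: prob_space D by (rule prob_space_D)
  define B' where "B' = max B 1"
  have B': "1 \<le> B'" "\<And>x. h x \<le> B'" using h by (auto simp: B'_def intro: max.coboundedI1)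
  define g where "g x = h x / B'" for x
  have [measurable]: "g \<in> borel_measurable borel" unfolding g_def by measurable
  have g: "0 \<le> g x" "g x \<le> 1" for x using h B' by (auto simp: g_def divide_le_eq)
  have gi: "0 \<le> (\<integral>x. g x \<partial>D)" "(\<integral>x. g x \<partial>D) \<le> 1"
    using g integrable_D_bounded[of g 1] by (auto intro!: integral_nonneg_AE D.integral_le_const)
  have gh: "(\<integral>x. h x \<partial>D) = B' * (\<integral>x. g x \<partial>D)" using B' by (simp add: g_def)
  have lim: "filterlim (\<lambda>n. real n / ln (real n)) at_top sequentially"
  proof -
    have "(\<lambda>n. ln (real n) / real n) \<longlonglongrightarrow> 0"
      by (rule filterlim_compose[OF ln_x_over_x_tendsto_0 filterlim_real_sequentially])
    moreover have "\<forall>\<^sub>F n in sequentially. 0 < ln (real n) / real n"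
      using eventually_gt_at_top[of 1] by eventually_elim auto
    ultimately have "filterlim (\<lambda>n. inverse (ln (real n) / real n)) at_top sequentially"
      by (rule filterlim_inverse_at_top)
    then show ?thesis by simp
  qed
  have "AE \<omega> in M. \<forall>\<epsilon>>0. \<forall>\<^sub>F n in sequentially. \<forall>k\<in>{g}.
    \<bar>(\<Sum>i=1..n. k (Xs i \<omega>)) - real n * (\<integral>x. k x \<partial>D)\<bar> \<le> \<epsilon> * (real n * (\<integral>x. k x \<partial>D) + real n)"
    by (rule AE_eventually_uniform_deviation[OF lim, where a=1]) (use g in auto)
  then show ?thesis
  proof eventually_elim
    case (elim \<omega>)
    have "(\<lambda>n. (\<Sum>i=1..n. g (Xs i \<omega>)) / real n) \<longlonglongrightarrow> (\<integral>x. g x \<partial>D)"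
    proof (rule tendstoI)
      fix e :: real assume e: "0 < e"
      then have "\<forall>\<^sub>F n in sequentially. \<bar>(\<Sum>i=1..n. g (Xs i \<omega>)) - real n * (\<integral>x. g x \<partial>D)\<bar>
         \<le> e / 3 * (real n * (\<integral>x. g x \<partial>D) + real n)"
        using elim[rule_format, of "e / 3"] by simp
      then show "\<forall>\<^sub>F n in sequentially. dist ((\<Sum>i=1..n. g (Xs i \<omega>)) / real n) (\<integral>x. g x \<partial>D) < e"
        using eventually_gt_at_top[of 0]
      proof eventually_elim
        case (elim n)
        have "real n * (\<integral>x. g x \<partial>D) \<le> real n" using gi by (simp add: mult_left_le)
        then have "\<bar>(\<Sum>i=1..n. g (Xs i \<omega>)) - real n * (\<integral>x. g x \<partial>D)\<bar> \<le> e / 3 * (real n + real n)"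
          using elim e by (intro order_trans[OF elim(1)] mult_left_mono) auto
        also have "\<dots> < e * real n" using e elim by simp
        finally have "\<bar>(\<Sum>i=1..n. g (Xs i \<omega>)) - real n * (\<integral>x. g x \<partial>D)\<bar> / real n < e"
          using elim by (simp add: divide_less_eq)
        moreover have "(\<Sum>i=1..n. g (Xs i \<omega>)) / real n - (\<integral>x. g x \<partial>D)
          = ((\<Sum>i=1..n. g (Xs i \<omega>)) - real n * (\<integral>x. g x \<partial>D)) / real n"
          using elim by (simp add: field_simps)
        ultimately show ?case by (simp add: dist_real_def)
      qed
    qed
    from tendsto_mult_left[OF this, of B']
    have "(\<lambda>n. B' * ((\<Sum>i=1..n. g (Xs i \<omega>)) / real n)) \<longlonglongrightarrow> (\<integral>x. h x \<partial>D)"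
      by (simp only: gh)
    moreover have "B' * ((\<Sum>i=1..n. g (Xs i \<omega>)) / real n) = (\<Sum>i=1..n. h (Xs i \<omega>)) / real n" for n
      using B' by (simp add: g_def flip: sum_divide_distrib)
    ultimately show ?case by (simp only:)
  qed
qed

end

section \<open>Order statistics and counts of sample points\<close>

lemma order_stat_mono:
  assumes "1 \<le> j" "j \<le> k" "k \<le> n"
  shows "order_stat n x j \<le> order_stat n x k"
  unfolding order_stat_def using assms by (intro sorted_nth_mono) auto

lemma sum_order_stat: "(\<Sum>k=1..n. h (order_stat n x k)) = (\<Sum>i=1..n. h (x i) :: real)"
proof -
  let ?xs = "map x [1..<n + 1]"
  define ys where "ys = sort ?xs"
  have len: "length ys = n" unfolding ys_def by (simp del: upt_Suc)
  have "(\<Sum>k=1..n. h (order_stat n x k)) = (\<Sum>k<n. h (ys ! k))"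
    unfolding order_stat_def ys_def[symmetric]
    by (rule sum.reindex_bij_witness[where i=Suc and j="\<lambda>k. k - 1"]) auto
  also have "\<dots> = sum_list (map h ys)"
    by (simp add: sum_list_sum_nth atLeast0LessThan len)
  also have "\<dots> = sum_list (map h ?xs)"
    unfolding ys_def by (simp only: sum_mset_sum_list[symmetric] mset_map mset_sort)
  also have "\<dots> = (\<Sum>i=1..n. h (x i))"
    by (simp only: map_map comp_def interv_sum_list_conv_sum_set_nat set_upt)
       (simp only: Suc_eq_plus1[symmetric] atLeastLessThanSuc_atLeastAtMost)
  finally show ?thesis .
qed

text \<open>In the presence of ties the number of sample points between two order statistics is not determined by their
ranks. The closed interval always contains at least \<open>m + 1\<close> points, and the open one at most
\<open>m - 1\<close>; both statements hold for every sample, whether it has ties or not.\<close>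

lemma count_closed_spacing:
  assumes "1 \<le> j" "j + m \<le> n"
  shows "real m + 1 \<le> (\<Sum>i=1..n. indicator {order_stat n x j..order_stat n x (j + m)} (x i))"
    (is "_ \<le> (\<Sum>i=1..n. ?h (x i))")
proof -
  have "real m + 1 = (\<Sum>k=j..j+m. 1)" by simp
  also have "\<dots> = (\<Sum>k=j..j+m. ?h (order_stat n x k))"
    using assms by (intro sum.cong refl) (auto simp: indicator_def intro!: order_stat_mono)
  also have "\<dots> \<le> (\<Sum>k=1..n. ?h (order_stat n x k))"
    using assms by (intro sum_mono2) auto
  finally show ?thesis by (simp only: sum_order_stat)
qed

lemma count_open_spacing:
  assumes "1 \<le> j" "j + m \<le> n" "1 \<le> m"
  shows "(\<Sum>i=1..n. indicator {order_stat n x j<..<order_stat n x (j + m)} (x i)) \<le> real m - 1"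
    (is "(\<Sum>i=1..n. ?h (x i)) \<le> _")
proof -
  have "(\<Sum>i=1..n. ?h (x i)) = (\<Sum>k=1..n. ?h (order_stat n x k))" by (simp only: sum_order_stat)
  also have "\<dots> \<le> (\<Sum>k=1..n. indicator {j<..<j+m} k)"
  proof (intro sum_mono)
    fix k assume "k \<in> {1..n}"
    then have "order_stat n x k \<le> order_stat n x j" if "k \<le> j"
      using that assms by (intro order_stat_mono) auto
    moreover have "order_stat n x (j + m) \<le> order_stat n x k" if "j + m \<le> k"
      using that assms \<open>k \<in> {1..n}\<close> by (intro order_stat_mono) auto
    ultimately show "?h (order_stat n x k) \<le> indicator {j<..<j+m} k"
      by (force simp: indicator_def)
  qed
  also have "\<dots> = (\<Sum>k\<in>{j<..<j+m}. 1)"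
    using assms by (intro sum.mono_neutral_cong_right) (auto simp: indicator_def)
  also have "\<dots> = real m - 1" using assms by (simp add: of_nat_diff)
  finally show ?thesis .
qed

section \<open>The probability integral transform\<close>

lemma (in real_distribution) cdf_hits:
  assumes "\<And>x. measure M {x} = 0" "0 < u" "u < 1"
  obtains q where "cdf M q = u"
proof -
  have "\<forall>\<^sub>F x in at_bot. cdf M x < u" "\<forall>\<^sub>F x in at_top. u < cdf M x"
    using cdf_lim_at_bot cdf_lim_at_top_prob assms by (auto intro: order_tendstoD)
  then obtain a b where ab: "\<And>x. x \<le> a \<Longrightarrow> cdf M x < u" "\<And>x. b \<le> x \<Longrightarrow> u < cdf M x"
    by (auto simp: eventually_at_bot_linorder eventually_at_top_linorder)
  have "\<exists>q\<ge>min a b. q \<le> max a b \<and> cdf M q = u"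
  proof (rule IVT)
    show "cdf M (min a b) \<le> u" "u \<le> cdf M (max a b)"
      using ab[of "min a b"] ab[of "max a b"] by auto
  qed (use assms isCont_cdf in auto)
  then show thesis using that by auto
qed

text \<open>For a continuous distribution function \<open>F\<close>, the variable \<open>F(X)\<close> is uniform. If
\<open>F q = v\<close>, then \<open>{F < v} \<subseteq> {..q} \<subseteq> {F \<le> v}\<close>, and the middle set has mass
\<open>v\<close>; moving \<open>v\<close> a little gives the inequalities in the other direction, and also covers
the levels \<open>0\<close> and \<open>1\<close>, which \<open>F\<close> need not attain.\<close>

lemma (in real_distribution) cdf_sublevel_bounds:
  assumes atomless: "\<And>x. measure M {x} = 0" and u: "0 \<le> u" "u \<le> 1"
  shows "measure M {x. cdf M x \<le> u} \<le> u" and "u \<le> measure M {x. cdf M x < u}"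
proof -
  have "cdf M \<in> borel_measurable borel"
    by (intro borel_measurable_mono monoI cdf_nondecreasing)
  then have m[measurable]: "cdf M \<in> borel_measurable M" by simp
  have S [measurable]: "{x. cdf M x \<le> v} \<in> sets M" "{x. cdf M x < v} \<in> sets M" for v
    using borel_measurable_le[OF m borel_measurable_const, of v] 
      borel_measurable_less[OF m borel_measurable_const, of v] by auto
  have in_range: "v \<le> measure M {x. cdf M x \<le> v}" "measure M {x. cdf M x < v} \<le> v"
    if v: "0 < v" "v < 1" for v
  proof -
    obtain q where q: "cdf M q = v" using cdf_hits[OF atomless v] .
    have "measure M {..q} \<le> measure M {x. cdf M x \<le> v}"
      using q cdf_nondecreasing by (intro finite_measure_mono) auto
    then show "v \<le> measure M {x. cdf M x \<le> v}" using q by (simp add: cdf_def)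
    have "{x. cdf M x < v} \<subseteq> {..q}"
    proof
      fix x assume "x \<in> {x. cdf M x < v}"
      then show "x \<in> {..q}" using q cdf_nondecreasing[of q x] by (cases "x \<le> q") auto
    qed
    then have "measure M {x. cdf M x < v} \<le> measure M {..q}" by (intro finite_measure_mono) auto
    then show "measure M {x. cdf M x < v} \<le> v" using q by (simp add: cdf_def)
  qed
  show "measure M {x. cdf M x \<le> u} \<le> u"
  proof (rule field_le_epsilon)
    fix e :: real assume e: "0 < e"
    show "measure M {x. cdf M x \<le> u} \<le> u + e"
    proof (cases "u + e < 1")
      case True
      have "measure M {x. cdf M x \<le> u} \<le> measure M {x. cdf M x < u + e}"
        using e by (intro finite_measure_mono) auto
      then show ?thesis using in_range(2)[of "u + e"] True e u by simp
    next
      case False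
      then show ?thesis using prob_le_1[of "{x. cdf M x \<le> u}"] by linarith
    qed
  qed
  show "u \<le> measure M {x. cdf M x < u}"
  proof (rule field_le_epsilon)
    fix e :: real assume e: "0 < e"
    show "u \<le> measure M {x. cdf M x < u} + e"
    proof (cases "0 < u - e")
      case True
      have "measure M {x. cdf M x \<le> u - e} \<le> measure M {x. cdf M x < u}"
        using e by (intro finite_measure_mono) auto
      then show ?thesis using in_range(1)[of "u - e"] True e u by simp
    next
      case False
      then show ?thesis using measure_nonneg[of M "{x. cdf M x < u}"] by linarith
    qed
  qed
qed

lemma (in real_distribution) prob_cdf_between:
  assumes atomless: "\<And>x. measure M {x} = 0" and uv: "0 \<le> u" "u \<le> v" "v \<le> 1"
  shows "measure M {x. u \<le> cdf M x \<and> cdf M x \<le> v} \<le> v - u"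
    and "v - u \<le> measure M {x. u < cdf M x \<and> cdf M x < v}"
proof -
  have "cdf M \<in> borel_measurable borel"
    by (intro borel_measurable_mono monoI cdf_nondecreasing)
  then have m[measurable]: "cdf M \<in> borel_measurable M" by simp
  have S [measurable]: "{x. cdf M x \<le> w} \<in> sets M" "{x. cdf M x < w} \<in> sets M" for w
    using borel_measurable_le[OF m borel_measurable_const, of w] 
      borel_measurable_less[OF m borel_measurable_const, of w] by auto
  have "{x. u \<le> cdf M x \<and> cdf M x \<le> v} = {x. cdf M x \<le> v} - {x. cdf M x < u}"
    by auto
  moreover have "measure M ({x. cdf M x \<le> v} - {x. cdf M x < u})
    = measure M {x. cdf M x \<le> v} - measure M {x. cdf M x < u}"
    using uv by (intro finite_measure_Diff S) auto
  ultimately show "measure M {x. u \<le> cdf M x \<and> cdf M x \<le> v} \<le> v - u"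
    using cdf_sublevel_bounds(1)[OF atomless, of v] cdf_sublevel_bounds(2)[OF atomless, of u] uv by simp
  have "{x. u < cdf M x \<and> cdf M x < v} = {x. cdf M x < v} - {x. cdf M x \<le> u}"
    by auto
  moreover have "measure M ({x. cdf M x < v} - {x. cdf M x \<le> u})
    = measure M {x. cdf M x < v} - measure M ({x. cdf M x < v} \<inter> {x. cdf M x \<le> u})"
    by (intro finite_measure_Diff' S)
  moreover have "measure M ({x. cdf M x < v} \<inter> {x. cdf M x \<le> u}) \<le> measure M {x. cdf M x \<le> u}"
    by (intro finite_measure_mono S) auto
  ultimately show "v - u \<le> measure M {x. u < cdf M x \<and> cdf M x < v}"
    using cdf_sublevel_bounds(1)[OF atomless, of u] cdf_sublevel_bounds(2)[OF atomless, of v] uv by simp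
qed

section \<open>Spacings on the uniform scale\<close>

definition (in real_distribution) cdf_cell_closed :: "nat \<Rightarrow> nat \<Rightarrow> nat \<Rightarrow> real set" where
  "cdf_cell_closed n i k = {x. real i / real n \<le> cdf M x \<and> cdf M x \<le> real k / real n}"

definition (in real_distribution) cdf_cell_open :: "nat \<Rightarrow> nat \<Rightarrow> nat \<Rightarrow> real set" where
  "cdf_cell_open n i k = {x. real i / real n < cdf M x \<and> cdf M x < real k / real n}"

text \<open>Rounding the levels \<open>F a\<close> and \<open>F b\<close> at two order statistics to the grid of multiples of
\<open>1 / n\<close>, outwards for a closed cell and inwards for an open one, changes the expected count by
at most \<open>2\<close>, hence by at most \<open>e * m\<close>. The expected count \<open>v - u\<close> of the spacing is then
compared with the actual count, which is essentially \<open>m\<close>.\<close>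

lemma (in real_distribution) cdf_spacing_near:
  fixes x :: "nat \<Rightarrow> real"
  assumes atomless: "\<And>x. measure M {x} = 0"
    and m: "1 \<le> m" and j: "1 \<le> j" "j + m \<le> n"
    and e: "0 < e" "e \<le> 1 / 2" and m2: "2 \<le> e * real m"
    and closed: "\<And>i k. i \<le> k \<Longrightarrow> k \<le> n \<Longrightarrow>
      \<bar>(\<Sum>l=1..n. indicator (cdf_cell_closed n i k) (x l)) - real n * measure M (cdf_cell_closed n i k)\<bar>
        \<le> e * (real n * measure M (cdf_cell_closed n i k) + real m)"
    and opened: "\<And>i k. i \<le> k \<Longrightarrow> k \<le> n \<Longrightarrow>
      \<bar>(\<Sum>l=1..n. indicator (cdf_cell_open n i k) (x l)) - real n * measure M (cdf_cell_open n i k)\<bar>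
        \<le> e * (real n * measure M (cdf_cell_open n i k) + real m)"
  shows "\<bar>real n * (cdf M (order_stat n x (j + m)) - cdf M (order_stat n x j)) - real m\<bar> \<le> 5 * e * real m"
proof -
  define a b where "a = order_stat n x j" and "b = order_stat n x (j + m)"
  have "a \<le> b" unfolding a_def b_def using j by (intro order_stat_mono) auto
  define u v where "u = real n * cdf M a" and "v = real n * cdf M b"
  have n: "0 < real n" using j by simp
  have uv: "0 \<le> u" "u \<le> v" "v \<le> real n"
    using \<open>a \<le> b\<close> cdf_nondecreasing[of a b] cdf_nonneg[of a] cdf_bounded_prob[of b] n
    by (auto simp: u_def v_def mult_left_le intro!: mult_left_mono)
  have Fa: "cdf M a = u / real n" and Fb: "cdf M b = v / real n"
    using n by (auto simp: u_def v_def)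
  have upper: "real m + 1 \<le> (1 + e) * (v - u + 2) + e * real m"
  proof -
    define i k where "i = nat \<lfloor>u\<rfloor>" and "k = nat \<lceil>v\<rceil>"
    have ik: "real i \<le> u" "v \<le> real k" "k \<le> n" "i \<le> k" "real k - real i \<le> v - u + 2"
      using uv unfolding i_def k_def by (linarith | simp add: le_nat_iff nat_le_iff ceiling_le_iff)+
    have "measure M (cdf_cell_closed n i k) \<le> real k / real n - real i / real n"
      unfolding cdf_cell_closed_def using ik n
      by (intro prob_cdf_between(1)[OF atomless]) (auto simp: divide_right_mono)
    then have P: "real n * measure M (cdf_cell_closed n i k) \<le> v - u + 2"
      using n ik by (simp add: field_simps)
    have "real m + 1 \<le> (\<Sum>l=1..n. indicator {a..b} (x l))"
      unfolding a_def b_def by (rule count_closed_spacing[OF j])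
    also have "\<dots> \<le> (\<Sum>l=1..n. indicator (cdf_cell_closed n i k) (x l))"
    proof (intro sum_mono)
      fix l
      have "real i / real n \<le> cdf M (x l)" "cdf M (x l) \<le> real k / real n"
        if "a \<le> x l" "x l \<le> b"
      proof -
        have "real i / real n \<le> cdf M a" "cdf M b \<le> real k / real n"
          unfolding Fa Fb using ik n by (auto intro: divide_right_mono)
        then show "real i / real n \<le> cdf M (x l)" "cdf M (x l) \<le> real k / real n"
          using cdf_nondecreasing[OF that(1)] cdf_nondecreasing[OF that(2)] by auto
      qed
      then show "indicator {a..b} (x l) \<le> (indicator (cdf_cell_closed n i k) (x l) :: real)"
        by (auto simp: cdf_cell_closed_def indicator_def)
    qed
    also have "\<dots> \<le> (1 + e) * (real n * measure M (cdf_cell_closed n i k)) + e * real m"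
      using closed[OF ik(4) ik(3)] by (simp add: algebra_simps)
    also have "\<dots> \<le> (1 + e) * (v - u + 2) + e * real m"
      using P e by (intro add_right_mono mult_left_mono) auto
    finally show ?thesis .
  qed
  have lower: "(1 - e) * (v - u - 2) - e * real m \<le> real m - 1"
  proof (cases "v - u \<le> 2")
    case True
    then have "(1 - e) * (v - u - 2) \<le> 0" using e by (simp add: mult_nonneg_nonpos)
    moreover have "1 \<le> real m" using m by simp
    ultimately show ?thesis using m2 by linarith
  next
    case False
    \<comment> \<open>Rounding inwards keeps \<open>i \<le> k\<close> since \<open>v - u > 2\<close>.\<close>
    define i k where "i = nat \<lceil>u\<rceil>" and "k = nat \<lfloor>v\<rfloor>"
    have ik: "u \<le> real i" "real k \<le> v" "k \<le> n" "i \<le> k" "v - u - 2 \<le> real k - real i"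
      using uv False unfolding i_def k_def by linarith+
    have "real k / real n - real i / real n \<le> measure M (cdf_cell_open n i k)"
      unfolding cdf_cell_open_def using ik n
      by (intro prob_cdf_between(2)[OF atomless]) (auto simp: divide_right_mono)
    then have P: "v - u - 2 \<le> real n * measure M (cdf_cell_open n i k)"
      using n ik by (simp add: field_simps)
    have "(1 - e) * (v - u - 2) - e * real m \<le> (1 - e) * (real n * measure M (cdf_cell_open n i k)) - e * real m"
      using P e by (intro diff_right_mono mult_left_mono) auto
    also have "\<dots> \<le> (\<Sum>l=1..n. indicator (cdf_cell_open n i k) (x l))"
      using opened[OF ik(4) ik(3)] by (simp add: algebra_simps)
    also have "\<dots> \<le> (\<Sum>l=1..n. indicator {a<..<b} (x l))"
    proof (intro sum_mono)
      fix l
      have "a < x l \<and> x l < b"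
        if "real i / real n < cdf M (x l)" "cdf M (x l) < real k / real n"
      proof -
        have "cdf M a \<le> real i / real n" "real k / real n \<le> cdf M b"
          unfolding Fa Fb using ik n by (auto intro: divide_right_mono)
        then have "cdf M a < cdf M (x l)" "cdf M (x l) < cdf M b" using that by auto
        then show ?thesis
          using cdf_nondecreasing[of "x l" a] cdf_nondecreasing[of b "x l"] by force
      qed
      then show "indicator (cdf_cell_open n i k) (x l) \<le> (indicator {a<..<b} (x l) :: real)"
        by (auto simp: cdf_cell_open_def indicator_def)
    qed
    also have "\<dots> \<le> real m - 1"
      unfolding a_def b_def using m by (intro count_open_spacing[OF j]) auto
    finally show ?thesis .
  qed
  have "real m - 5 * e * real m \<le> v - u"
  proof -
    have "(1 + e) * (real m - 5 * e * real m) \<le> (1 + e) * (v - u)"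
    proof -
      have "(1 + e) * (real m - 5 * e * real m) = real m - 4 * e * real m - 5 * (e * (e * real m))"
        by (simp add: algebra_simps)
      moreover have "0 \<le> e * (e * real m)" using e by simp
      moreover have "(1 + e) * (v - u + 2) = (1 + e) * (v - u) + 2 + 2 * e" by (simp add: algebra_simps)
      ultimately show ?thesis using upper m2 e by linarith
    qed
    then show ?thesis using e by simp
  qed
  moreover have "v - u \<le> real m + 5 * e * real m"
  proof -
    have "(1 - e) * (v - u) \<le> (1 - e) * (real m + 5 * e * real m)"
    proof -
      have "(1 - e) * (real m + 5 * e * real m) = real m + 4 * e * real m - 5 * (e * (e * real m))"
        by (simp add: algebra_simps)
      moreover have "e * (e * real m) \<le> 1/2 * (e * real m)"
        using e by (intro mult_right_mono) auto
      moreover have "(1 - e) * (v - u - 2) = (1 - e) * (v - u) - 2 + 2 * e" by (simp add: algebra_simps)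
      ultimately show ?thesis using lower m2 e by linarith
    qed
    then show ?thesis using e by simp
  qed
  ultimately show ?thesis
    by (simp add: a_def[symmetric] b_def[symmetric] right_diff_distrib u_def[symmetric] v_def[symmetric] abs_le_iff)
qed

context iid_sample begin

lemma real_distribution_D: "real_distribution D"
proof -
  interpret D: prob_space D by (rule prob_space_D)
  show ?thesis by unfold_locales (auto simp: sets_eq_imp_space_eq[OF sets_D])
qed

text \<open>For each \<open>n\<close> there are about \<open>n\<^sup>2\<close> grid cells, few enough for the uniform deviation bound
at scale \<open>m n\<close>. Every spacing then has nearly the mass \<open>m / n\<close> that it should have,
simultaneously for all ranks.\<close>

lemma AE_uniform_cdf_spacing:
  fixes m :: "nat \<Rightarrow> nat"
  assumes atomless: "\<And>x. measure D {x} = 0"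
    and m_range: "\<And>n. 1 \<le> n \<Longrightarrow> 1 \<le> m n"
    and m_infinity: "filterlim m at_top sequentially"
    and m_log: "filterlim (\<lambda>n. real (m n) / ln (real n)) at_top sequentially"
  shows "AE \<omega> in M. \<forall>\<epsilon>>0. \<forall>\<^sub>F n in sequentially. \<forall>j\<in>{1..n - m n}.
    \<bar>real n * (cdf D (order_stat n (\<lambda>i. Xs i \<omega>) (j + m n)) - cdf D (order_stat n (\<lambda>i. Xs i \<omega>) j)) - real (m n)\<bar>
      \<le> \<epsilon> * real (m n)"
proof -
  interpret D: real_distribution D by (rule real_distribution_D)
  define H :: "nat \<Rightarrow> (real \<Rightarrow> real) set" where
    "H n = (\<lambda>(i, k). indicator (D.cdf_cell_closed n i k)) ` ({..n} \<times> {..n})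
      \<union> (\<lambda>(i, k). indicator (D.cdf_cell_open n i k)) ` ({..n} \<times> {..n})" for n
  have cdf_m [measurable]: "cdf D \<in> borel_measurable borel"
    by (intro borel_measurable_mono monoI D.cdf_nondecreasing)
  have cell_m: "D.cdf_cell_closed n i k \<in> sets borel" "D.cdf_cell_open n i k \<in> sets borel" for n i k
  proof -
    have "D.cdf_cell_closed n i k = cdf D -` {real i / real n..real k / real n} \<inter> space borel"
      "D.cdf_cell_open n i k = cdf D -` {real i / real n<..<real k / real n} \<inter> space borel"
      by (auto simp: D.cdf_cell_closed_def D.cdf_cell_open_def)
    then show "D.cdf_cell_closed n i k \<in> sets borel" "D.cdf_cell_open n i k \<in> sets borel"
      using measurable_sets[OF cdf_m, of "{real i / real n..real k / real n}"]
        measurable_sets[OF cdf_m, of "{real i / real n<..<real k / real n}"] by auto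
  qed
  have card_le: "real (card (H n)) \<le> 8 * (real n)\<^sup>2" if "1 \<le> n" for n
  proof -
    have "card (H n) \<le> card ({..n} \<times> {..n}) + card ({..n} \<times> {..n})"
      unfolding H_def by (intro order_trans[OF card_Un_le] add_mono card_image_le) auto
    then have "real (card (H n)) \<le> real (card ({..n} \<times> {..n}) + card ({..n} \<times> {..n}))"
      by (rule of_nat_mono)
    also have "\<dots> = 2 * (real n + 1)\<^sup>2" by (simp add: power2_eq_square algebra_simps)
    also have "\<dots> \<le> 2 * (real n + real n)\<^sup>2" using that by (intro mult_left_mono power_mono) auto
    finally show ?thesis by (simp add: power2_eq_square)
  qed
  have "AE \<omega> in M. \<forall>\<epsilon>>0. \<forall>\<^sub>F n in sequentially. \<forall>h\<in>H n.
    \<bar>(\<Sum>i=1..n. h (Xs i \<omega>)) - real n * (\<integral>x. h x \<partial>D)\<bar> \<le> \<epsilon> * (real n * (\<integral>x. h x \<partial>D) + real (m n))"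
    by (rule AE_eventually_uniform_deviation[OF m_log _ card_le])
      (auto simp: H_def intro!: borel_measurable_indicator cell_m)
  then show ?thesis
  proof eventually_elim
    case (elim \<omega>)
    let ?os = "\<lambda>n. order_stat n (\<lambda>i. Xs i \<omega>)"
    show ?case
    proof (intro allI impI)
      fix \<epsilon> :: real assume "0 < \<epsilon>"
      define e where "e = min (1/2) (\<epsilon> / 5)"
      have e: "0 < e" "e \<le> 1/2" "5 * e \<le> \<epsilon>" using \<open>0 < \<epsilon>\<close> by (auto simp: e_def)
      have "filterlim (\<lambda>n. real (m n)) at_top sequentially"
        using m_infinity filterlim_compose filterlim_real_sequentially by blast
      then have "\<forall>\<^sub>F n in sequentially. 2 / e \<le> real (m n)"
        by (simp add: filterlim_at_top)
      then show "\<forall>\<^sub>F n in sequentially. \<forall>j\<in>{1..n - m n}.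
        \<bar>real n * (cdf D (?os n (j + m n)) - cdf D (?os n j)) - real (m n)\<bar> \<le> \<epsilon> * real (m n)"
        using elim[rule_format, OF e(1)] eventually_ge_at_top[of 1]
      proof eventually_elim
        case (elim n)
        have m2: "2 \<le> e * real (m n)" using elim(1) e by (simp add: field_simps)
        have in_H: "indicator (D.cdf_cell_closed n i k) \<in> H n" "indicator (D.cdf_cell_open n i k) \<in> H n"
          if "i \<le> k" "k \<le> n" for i k
          using that by (force simp: H_def)+
        have cell_int: "(\<integral>x. indicator (D.cdf_cell_closed n i k) x \<partial>D) = measure D (D.cdf_cell_closed n i k)"
          "(\<integral>x. indicator (D.cdf_cell_open n i k) x \<partial>D) = measure D (D.cdf_cell_open n i k)" for i k
          by simp_all
        show ?case
        proof
          fix j assume j: "j \<in> {1..n - m n}"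
          have "\<bar>real n * (cdf D (?os n (j + m n)) - cdf D (?os n j)) - real (m n)\<bar> \<le> 5 * e * real (m n)"
            by (rule D.cdf_spacing_near[OF atomless _ _ _ e(1,2) m2])
              (use j m_range[OF elim(3)] elim(2)[rule_format, OF in_H(1), unfolded cell_int]
                elim(2)[rule_format, OF in_H(2), unfolded cell_int] in auto)
          also have "\<dots> \<le> \<epsilon> * real (m n)" using e by (intro mult_right_mono) auto
          finally show "\<bar>real n * (cdf D (?os n (j + m n)) - cdf D (?os n j)) - real (m n)\<bar> \<le> \<epsilon> * real (m n)" .
        qed
      qed
    qed
  qed
qed

end

section \<open>Continuous approximation of a bounded density\<close>

text \<open>A tent function first cuts \<open>f\<close> down to a bounded set. There, dominated convergence applies to
continuous functions that tend to \<open>f\<close> almost everywhere, truncated to the range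
\<open>[0, B]\<close>. The approximation keeps the bound \<open>B\<close>, so that averages of \<open>\<phi>\<close> can be
bounded like those of \<open>f\<close>.\<close>

lemma L1_approx_continuous_compact_support:
  fixes f :: "real \<Rightarrow> real"
  assumes f: "integrable lborel f" and f0: "\<And>x. 0 \<le> f x" and fB: "\<And>x. f x \<le> B" and e: "0 < e"
  obtains \<phi> K where "continuous_on UNIV \<phi>" "\<And>x. 0 \<le> \<phi> x" "\<And>x. \<phi> x \<le> B"
    "0 < K" "\<And>x. K < \<bar>x\<bar> \<Longrightarrow> \<phi> x = 0" "integrable lborel \<phi>" "(\<integral>x. \<bar>f x - \<phi> x\<bar> \<partial>lborel) < e"
proof -
  have [measurable]: "f \<in> borel_measurable borel" using f by (simp add: borel_measurable_integrable flip: measurable_lborel1)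
  have B0: "0 \<le> B" using f0[of 0] fB[of 0] by simp
  define \<psi> :: "nat \<Rightarrow> real \<Rightarrow> real" where "\<psi> k x = max 0 (min 1 (real k + 1 - \<bar>x\<bar>))" for k x
  have \<psi>c: "continuous_on UNIV (\<psi> k)" for k unfolding \<psi>_def by (intro continuous_intros)
  have [measurable]: "\<psi> k \<in> borel_measurable borel" for k using \<psi>c by (rule borel_measurable_continuous_onI)
  have \<psi>: "0 \<le> \<psi> k x" "\<psi> k x \<le> 1" "real k + 1 \<le> \<bar>x\<bar> \<Longrightarrow> \<psi> k x = 0" for k x by (auto simp: \<psi>_def)
  have "(\<lambda>k. \<integral>x. \<bar>f x - \<psi> k x * f x\<bar> \<partial>lborel) \<longlonglongrightarrow> (\<integral>x. 0 \<partial>(lborel :: real measure))"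
  proof (rule integral_dominated_convergence[where w=f])
    show "AE x in lborel. (\<lambda>k. \<bar>f x - \<psi> k x * f x\<bar>) \<longlonglongrightarrow> 0"
    proof (rule AE_I2)
      fix x
      obtain k0 where k0: "\<bar>x\<bar> \<le> real k0" using real_arch_simple by blast
      have "\<forall>\<^sub>F k in sequentially. \<bar>f x - \<psi> k x * f x\<bar> = 0"
        using eventually_ge_at_top[of k0] by eventually_elim (use k0 in \<open>auto simp: \<psi>_def max_def min_def\<close>)
      then show "(\<lambda>k. \<bar>f x - \<psi> k x * f x\<bar>) \<longlonglongrightarrow> 0" by (rule tendsto_eventually)
    qed
    show "AE x in lborel. norm \<bar>f x - \<psi> k x * f x\<bar> \<le> f x" for k
    proof (rule AE_I2)
      fix x
      have "0 \<le> \<psi> k x * f x" "\<psi> k x * f x \<le> f x" using \<psi>[of k x] f0[of x] by (auto simp: mult_left_le_one_le)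
      then show "norm \<bar>f x - \<psi> k x * f x\<bar> \<le> f x" by simp
    qed
  qed (use f in auto)
  then have "\<forall>\<^sub>F k in sequentially. (\<integral>x. \<bar>f x - \<psi> k x * f x\<bar> \<partial>lborel) < e / 2"
    using e by (intro order_tendstoD(2)) auto
  then obtain k where k: "(\<integral>x. \<bar>f x - \<psi> k x * f x\<bar> \<partial>lborel) < e / 2"
    by (auto simp: eventually_sequentially)
  have "f measurable_on UNIV"
    using measurable_completion[OF borel_measurable_integrable[OF f]]
    by (intro lebesgue_measurable_imp_measurable_on) auto
  then obtain N g where N: "negligible N" and g: "\<And>n. continuous_on UNIV (g n :: real \<Rightarrow> real)"
    and gf: "\<And>x. x \<notin> N \<Longrightarrow> (\<lambda>n. g n x) \<longlonglongrightarrow> f x"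
    unfolding measurable_on_def by auto
  define c where "c n x = max 0 (min B (g n x))" for n x
  have cc: "continuous_on UNIV (c n)" for n unfolding c_def by (intro continuous_intros g)
  have [measurable]: "c n \<in> borel_measurable borel" for n using cc by (rule borel_measurable_continuous_onI)
  have c: "0 \<le> c n x" "c n x \<le> B" for n x using B0 by (auto simp: c_def)
  have "AE x in lebesgue. x \<notin> N"
    using N by (auto simp: negligible_iff_null_sets intro: AE_not_in)
  then have AEN: "AE x in lborel. x \<notin> N" by (simp add: AE_completion_iff)
  have dom: "integrable lborel (\<lambda>x. B * indicator {-(real k + 1)..real k + 1} x)" by simp
  have "(\<lambda>n. \<integral>x. \<bar>\<psi> k x * f x - \<psi> k x * c n x\<bar> \<partial>lborel) \<longlonglongrightarrow> (\<integral>x. 0 \<partial>(lborel :: real measure))"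
  proof (rule integral_dominated_convergence[OF _ _ dom])
    show "AE x in lborel. (\<lambda>n. \<bar>\<psi> k x * f x - \<psi> k x * c n x\<bar>) \<longlonglongrightarrow> 0"
      using AEN
    proof eventually_elim
      case (elim x)
      have "(\<lambda>n. c n x) \<longlonglongrightarrow> max 0 (min B (f x))"
        unfolding c_def by (intro tendsto_intros gf elim)
      also have "max 0 (min B (f x)) = f x" using f0[of x] fB[of x] by simp
      finally have "(\<lambda>n. \<bar>\<psi> k x * f x - \<psi> k x * c n x\<bar>) \<longlonglongrightarrow> \<bar>\<psi> k x * f x - \<psi> k x * f x\<bar>"
        by (intro tendsto_intros)
      then show ?case by simp
    qed
    show "AE x in lborel. norm \<bar>\<psi> k x * f x - \<psi> k x * c n x\<bar> \<le> B * indicator {-(real k + 1)..real k + 1} x" for n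
    proof (rule AE_I2)
      fix x
      have "\<bar>f x - c n x\<bar> \<le> B" using f0[of x] fB[of x] c[of n x] by simp
      then have "\<psi> k x * \<bar>f x - c n x\<bar> \<le> 1 * B" using \<psi> by (intro mult_mono) auto
      then show "norm \<bar>\<psi> k x * f x - \<psi> k x * c n x\<bar> \<le> B * indicator {-(real k + 1)..real k + 1} x"
        using \<psi>[of k x] by (auto simp: indicator_def abs_mult abs_le_iff not_le simp flip: right_diff_distrib)
    qed
  qed auto
  then have "\<forall>\<^sub>F n in sequentially. (\<integral>x. \<bar>\<psi> k x * f x - \<psi> k x * c n x\<bar> \<partial>lborel) < e / 2"
    using e by (intro order_tendstoD(2)) auto
  then obtain n where n: "(\<integral>x. \<bar>\<psi> k x * f x - \<psi> k x * c n x\<bar> \<partial>lborel) < e / 2"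
    by (auto simp: eventually_sequentially)
  define \<phi> where "\<phi> x = \<psi> k x * c n x" for x
  have \<phi>: "0 \<le> \<phi> x" "\<phi> x \<le> B" for x
    using \<psi>[of k x] c[of n x] mult_mono[of "\<psi> k x" 1 "c n x" B] by (auto simp: \<phi>_def)
  have supp: "\<phi> x = 0" if "real k + 1 < \<bar>x\<bar>" for x using \<psi>(3)[of k x] that by (simp add: \<phi>_def)
  have [measurable]: "\<phi> \<in> borel_measurable borel" unfolding \<phi>_def by measurable
  have i\<phi>: "integrable lborel \<phi>"
  proof (rule Bochner_Integration.integrable_bound[OF dom])
    show "AE x in lborel. norm (\<phi> x) \<le> norm (B * indicator {-(real k + 1)..real k + 1} x)"
    proof (rule AE_I2)
      fix x
      show "norm (\<phi> x) \<le> norm (B * indicator {-(real k + 1)..real k + 1} x)"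
        using \<phi>[of x] supp[of x] B0 by (cases "real k + 1 < \<bar>x\<bar>") (auto simp: indicator_def)
    qed
  qed auto
  have i\<psi>: "integrable lborel (\<lambda>x. \<psi> k x * f x)"
  proof (rule Bochner_Integration.integrable_bound[OF f])
    show "AE x in lborel. norm (\<psi> k x * f x) \<le> norm (f x)"
      using \<psi> f0 by (auto simp: abs_mult mult_left_le_one_le)
  qed auto
  have "(\<integral>x. \<bar>f x - \<phi> x\<bar> \<partial>lborel) \<le> (\<integral>x. \<bar>f x - \<psi> k x * f x\<bar> + \<bar>\<psi> k x * f x - \<phi> x\<bar> \<partial>lborel)"
    using f i\<phi> i\<psi> by (intro integral_mono) auto
  also have "\<dots> = (\<integral>x. \<bar>f x - \<psi> k x * f x\<bar> \<partial>lborel) + (\<integral>x. \<bar>\<psi> k x * f x - \<phi> x\<bar> \<partial>lborel)"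
    using f i\<phi> i\<psi> by (intro Bochner_Integration.integral_add) auto
  also have "\<dots> < e" using k n by (simp add: \<phi>_def)
  finally have "(\<integral>x. \<bar>f x - \<phi> x\<bar> \<partial>lborel) < e" .
  moreover have "continuous_on UNIV \<phi>" unfolding \<phi>_def by (intro continuous_intros \<psi>c cc)
  ultimately show thesis using that[of \<phi> "real k + 1"] \<phi> supp i\<phi> by auto
qed

lemma uniformly_continuous_compact_support:
  fixes \<phi> :: "real \<Rightarrow> real"
  assumes c: "continuous_on UNIV \<phi>" and supp: "\<And>x. K < \<bar>x\<bar> \<Longrightarrow> \<phi> x = 0" and \<eta>: "0 < \<eta>"
  obtains \<delta> where "0 < \<delta>" "\<And>y z. \<bar>y - z\<bar> \<le> \<delta> \<Longrightarrow> \<bar>\<phi> y - \<phi> z\<bar> \<le> \<eta>"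
proof -
  have "uniformly_continuous_on {-(K + 1)..K + 1} \<phi>"
    by (intro compact_uniformly_continuous continuous_on_subset[OF c]) auto
  then obtain d where d: "0 < d"
    "\<And>y z. y \<in> {-(K + 1)..K + 1} \<Longrightarrow> z \<in> {-(K + 1)..K + 1} \<Longrightarrow> dist y z < d \<Longrightarrow> dist (\<phi> y) (\<phi> z) < \<eta>"
    using \<eta> unfolding uniformly_continuous_on_def by metis
  show thesis
  proof (rule that[of "min (d / 2) 1"])
    fix y z :: real assume yz: "\<bar>y - z\<bar> \<le> min (d / 2) 1"
    show "\<bar>\<phi> y - \<phi> z\<bar> \<le> \<eta>"
    proof (cases "y \<in> {-(K + 1)..K + 1} \<and> z \<in> {-(K + 1)..K + 1}")
      case True
      then show ?thesis using d(1) d(2)[of y z] yz by (auto simp: dist_real_def)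
    next
      case False
      then have "K < \<bar>y\<bar> \<and> K < \<bar>z\<bar>" using yz by auto
      then show ?thesis using supp[of y] supp[of z] \<eta> by simp
    qed
  qed (use d in auto)
qed

section \<open>Overlapping spacings\<close>

text \<open>If \<open>a\<close> is the smallest rank whose spacing contains \<open>t\<close>, then \<open>t \<le> x (a + m)\<close>, so
that no spacing starting at rank \<open>a + m\<close> or later contains \<open>t\<close>.\<close>

lemma card_spacings_containing:
  fixes x :: "nat \<Rightarrow> real"
  assumes mono: "\<And>j k. 1 \<le> j \<Longrightarrow> j \<le> k \<Longrightarrow> k \<le> n \<Longrightarrow> x j \<le> x k"
  shows "card {j \<in> {1..n - m}. x j < t \<and> t \<le> x (j + m)} \<le> m"
proof (cases "{j \<in> {1..n - m}. x j < t \<and> t \<le> x (j + m)} = {}")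
  case False
  define J where "J = {j \<in> {1..n - m}. x j < t \<and> t \<le> x (j + m)}"
  have J: "finite J" "J \<noteq> {}" using False by (auto simp: J_def)
  define a where "a = Min J"
  have a: "a \<in> J" using J by (simp add: a_def)
  have "J \<subseteq> {a..<a + m}"
  proof
    fix k assume k: "k \<in> J"
    have "a \<le> k" using J k by (simp add: a_def)
    moreover have "k < a + m"
    proof (rule ccontr)
      assume "\<not> k < a + m"
      then have "x (a + m) \<le> x k" using a k by (intro mono) (auto simp: J_def)
      then show False using a k by (auto simp: J_def)
    qed
    ultimately show "k \<in> {a..<a + m}" by simp
  qed
  then have "card J \<le> card {a..<a + m}" by (intro card_mono) auto
  then show ?thesis by (simp add: J_def)
next
  case True
  then show ?thesis by (simp only: card.empty)
qed

text \<open>This replaces a maximal inequality: the total contribution of an error that is small in \<open>L\<^sup>1\<close>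
is at most \<open>m\<close> times its norm, and the factor \<open>m\<close> is compensated by the length of the
spacings, which is at least of order \<open>m / n\<close>.\<close>

lemma sum_integrals_over_spacings:
  fixes x :: "nat \<Rightarrow> real"
  fixes h :: "real \<Rightarrow> real"
  assumes mono: "\<And>j k. 1 \<le> j \<Longrightarrow> j \<le> k \<Longrightarrow> k \<le> n \<Longrightarrow> x j \<le> x k"
    and h: "integrable lborel h" and h0: "\<And>t. 0 \<le> h t"
  shows "(\<Sum>j=1..n - m. \<integral>t. indicator {x j<..x (j + m)} t * h t \<partial>lborel) \<le> real m * (\<integral>t. h t \<partial>lborel)"
proof -
  have int: "integrable lborel (\<lambda>t. indicator {x j<..x (j + m)} t * h t)" for j
    using integrable_mult_indicator[of "{x j<..x (j + m)}" lborel h] h by simp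
  have "(\<Sum>j=1..n - m. \<integral>t. indicator {x j<..x (j + m)} t * h t \<partial>lborel)
      = (\<integral>t. (\<Sum>j=1..n - m. indicator {x j<..x (j + m)} t * h t) \<partial>lborel)"
    using int by (intro Bochner_Integration.integral_sum[symmetric]) auto
  also have "\<dots> \<le> (\<integral>t. real m * h t \<partial>lborel)"
  proof (rule integral_mono)
    fix t
    have "(\<Sum>j=1..n - m. indicator {x j<..x (j + m)} t :: real)
        = real (card {j \<in> {1..n - m}. x j < t \<and> t \<le> x (j + m)})"
      unfolding card_eq_sum of_nat_sum
      by (intro sum.mono_neutral_cong_right) (auto simp: indicator_def)
    also have "\<dots> \<le> real m" using card_spacings_containing[OF mono] by simp
    finally show "(\<Sum>j=1..n - m. indicator {x j<..x (j + m)} t * h t) \<le> real m * h t"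
      unfolding sum_distrib_right[symmetric] using h0 by (intro mult_right_mono) auto
  qed (intro Bochner_Integration.integrable_sum integrable_mult_right int h)+
  also have "\<dots> = real m * (\<integral>t. h t \<partial>lborel)" by simp
  finally show ?thesis .
qed

section \<open>The error of the spacing estimates\<close>

lemma integrable_indicator_interval:
  fixes a b c :: real
  shows "integrable lborel (\<lambda>t. indicator {a<..b} t * c)"
    and "integrable lborel (\<lambda>t. indicator {a..b} t * c)"
  by (cases "a \<le> b"; auto intro!: integrable_mult_left integrable_real_indicator)+

text \<open>A short interval is handled by uniform continuity, and an interval that avoids the support gives
\<open>0 = 0\<close>. A long interval meeting the support covers a length of at least \<open>\<delta>\<close> in the
enlarged support, so the trivial bound \<open>B\<close> can be charged to the integral of the indicator. Since
spacings overlap at most \<open>m\<close> times, the sum of these charges is of order \<open>m\<close>, negligible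
against \<open>n\<close>.\<close>

lemma average_near_left_endpoint:
  fixes \<phi> :: "real \<Rightarrow> real"
  assumes ab: "a < b" and \<phi>: "\<phi> \<in> borel_measurable borel" "\<And>y. 0 \<le> \<phi> y" "\<And>y. \<phi> y \<le> B"
    and supp: "\<And>y. K < \<bar>y\<bar> \<Longrightarrow> \<phi> y = 0" and "0 < \<delta>" "0 < K"
    and uc: "\<And>y z. \<bar>y - z\<bar> \<le> \<delta> \<Longrightarrow> \<bar>\<phi> y - \<phi> z\<bar> \<le> \<eta>"
  shows "\<bar>(\<integral>t. indicator {a<..b} t * \<phi> t \<partial>lborel) / (b - a) - \<phi> a\<bar>
    \<le> \<eta> + B / \<delta> * (\<integral>t. indicator {a<..b} t * indicator {-(K + \<delta>)..K + \<delta>} t \<partial>lborel)"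
    (is "\<bar>?avg - _\<bar> \<le> _ + B / \<delta> * ?I")
proof -
  note [measurable] = \<phi>(1)
  have B0: "0 \<le> B" using \<phi>(2,3)[of 0] by simp
  have \<eta>0: "0 \<le> \<eta>" using uc[of 0 0] \<open>0 < \<delta>\<close> by simp
  have I0: "0 \<le> ?I" by (intro integral_nonneg_AE) auto
  have int: "integrable lborel (\<lambda>t. indicator {a<..b} t * \<phi> t)"
    by (rule Bochner_Integration.integrable_bound[OF integrable_indicator_interval(1)[of a b B]])
       (use \<phi> B0 in \<open>auto simp: indicator_def abs_le_iff intro: order_trans[of _ 0]\<close>)
  have const: "(\<integral>t. indicator {a<..b} t * c \<partial>lborel) = (b - a) * c" for c :: real using ab by simp
  have avg_bounds: "l \<le> ?avg \<and> ?avg \<le> u" if "\<And>t. a < t \<Longrightarrow> t \<le> b \<Longrightarrow> l \<le> \<phi> t \<and> \<phi> t \<le> u" for l u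
  proof -
    have "(\<integral>t. indicator {a<..b} t * l \<partial>lborel) \<le> (\<integral>t. indicator {a<..b} t * \<phi> t \<partial>lborel)"
      "(\<integral>t. indicator {a<..b} t * \<phi> t \<partial>lborel) \<le> (\<integral>t. indicator {a<..b} t * u \<partial>lborel)"
      using that
      by (intro integral_mono int integrable_indicator_interval; auto simp: indicator_def)+
    then show ?thesis unfolding const using ab by (simp add: field_simps)
  qed
  consider "b - a \<le> \<delta>" | "b < - K \<or> K < a" | "\<delta> < b - a" "- K \<le> b" "a \<le> K" by linarith
  then show ?thesis
  proof cases
    case 1
    have "\<phi> a - \<eta> \<le> ?avg \<and> ?avg \<le> \<phi> a + \<eta>"
    proof (rule avg_bounds)
      fix t assume "a < t" "t \<le> b"
      then have "\<bar>\<phi> t - \<phi> a\<bar> \<le> \<eta>" using 1 by (intro uc) auto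
      then show "\<phi> a - \<eta> \<le> \<phi> t \<and> \<phi> t \<le> \<phi> a + \<eta>" by linarith
    qed
    moreover have "0 \<le> B / \<delta> * ?I" using B0 \<open>0 < \<delta>\<close> I0 by simp
    ultimately show ?thesis by linarith
  next
    case 2
    have "0 \<le> ?avg \<and> ?avg \<le> 0"
      by (rule avg_bounds) (use 2 \<open>0 < K\<close> in \<open>auto simp: supp\<close>)
    moreover have "\<phi> a = 0" using 2 \<open>0 < K\<close> ab by (intro supp) auto
    moreover have "0 \<le> B / \<delta> * ?I" using B0 \<open>0 < \<delta>\<close> I0 by simp
    ultimately show ?thesis using \<eta>0 by linarith
  next
    case 3
    have "0 \<le> ?avg \<and> ?avg \<le> B" by (rule avg_bounds) (use \<phi> in auto)
    then have "\<bar>?avg - \<phi> a\<bar> \<le> B" using \<phi>(2,3)[of a] by linarith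
    moreover have "B \<le> B / \<delta> * ?I"
    proof -
      define l r where "l = max a (-(K + \<delta>))" and "r = min b (K + \<delta>)"
      have lr: "\<delta> \<le> r - l" using 3 \<open>0 < K\<close> \<open>0 < \<delta>\<close> by (auto simp: l_def r_def min_def max_def)
      have "r - l = (\<integral>t. indicator {l<..r} t \<partial>lborel)" using lr \<open>0 < \<delta>\<close> by simp
      also have "\<dots> \<le> ?I"
      proof (rule integral_mono)
        show "integrable lborel (\<lambda>t. indicator {a<..b} t * indicator {-(K + \<delta>)..K + \<delta>} t :: real)"
          by (rule Bochner_Integration.integrable_bound[OF integrable_indicator_interval(1)[of a b 1]]) (auto simp: indicator_def)
      qed (use integrable_indicator_interval(1)[of l r 1] in \<open>auto simp: l_def r_def indicator_def\<close>)
      finally have "\<delta> \<le> ?I" using lr by linarith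
      then have "B / \<delta> * \<delta> \<le> B / \<delta> * ?I" using B0 \<open>0 < \<delta>\<close> by (intro mult_left_mono) auto
      then show ?thesis using \<open>0 < \<delta>\<close> by simp
    qed
    ultimately show ?thesis using \<eta>0 by linarith
  qed
qed

text \<open>A spacing of mass at least \<open>m / (2 n)\<close> under a density bounded by \<open>B\<close> has length at least
\<open>m / (2 n B)\<close>; in particular it is not degenerate.\<close>

lemma spacing_estimate_bounded:
  fixes f :: "real \<Rightarrow> real"
  assumes n: "1 \<le> n" and m: "1 \<le> m"
    and f: "integrable lborel f" "\<And>y. f y \<le> B"
    and ab: "a \<le> b" and e: "e \<le> 1 / 2"
    and spacing: "\<bar>real n * (\<integral>t. indicator {a<..b} t * f t \<partial>lborel) - real m\<bar> \<le> e * real m"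
  shows "a < b" and "1 / (b - a) \<le> 2 * real n * B / real m"
    and "real m / (real n + 1) * inverse (b - a) \<le> 2 * B"
proof -
  define p where "p = (\<integral>t. indicator {a<..b} t * f t \<partial>lborel)"
  have int: "integrable lborel (\<lambda>t. indicator {a<..b} t * f t)"
    using integrable_mult_indicator[of "{a<..b}" lborel f] f by simp
  have "p \<le> (\<integral>t. indicator {a<..b} t * B \<partial>lborel)"
    unfolding p_def using f(2)
    by (intro integral_mono int integrable_indicator_interval) (auto simp: indicator_def)
  then have pB: "p \<le> (b - a) * B" using ab by simp
  have "e * real m \<le> 1 / 2 * real m" using e by (intro mult_right_mono) auto
  then have half: "real m / 2 \<le> real n * p" using spacing unfolding p_def by linarith
  then have "0 < real n * p" using m by linarith
  then have p0: "0 < p" using n by (simp add: zero_less_mult_iff)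
  show ab': "a < b"
  proof (rule ccontr)
    assume "\<not> a < b"
    then show False using p0 pB ab by simp
  qed
  have "real n * p \<le> real n * ((b - a) * B)" using pB by (intro mult_left_mono) auto
  then have "real m \<le> 2 * real n * B * (b - a)" using half by (simp add: algebra_simps)
  then show invL: "1 / (b - a) \<le> 2 * real n * B / real m"
    using ab' m by (simp add: field_simps)
  have "real m / (real n + 1) * inverse (b - a) \<le> real m / real n * (1 / (b - a))"
    unfolding inverse_eq_divide using n ab' by (intro mult_mono divide_left_mono) auto
  also have "\<dots> \<le> real m / real n * (2 * real n * B / real m)"
    using invL by (intro mult_left_mono) auto
  also have "\<dots> = 2 * B" using n m by simp
  finally show "real m / (real n + 1) * inverse (b - a) \<le> 2 * B" .
qed

text \<open>The path from the estimate \<open>s\<close> to \<open>f a\<close> goes over the average of \<open>f\<close> on the spacing, the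
average of \<open>\<phi>\<close>, and \<open>\<phi> a\<close>; the four summands bound the four steps in this order.\<close>

lemma spacing_estimate_error:
  fixes f \<phi> :: "real \<Rightarrow> real"
  assumes n: "1 \<le> n" and m: "1 \<le> m"
    and f: "integrable lborel f" "\<And>y. f y \<le> B"
    and \<phi>: "integrable lborel \<phi>" "\<And>y. 0 \<le> \<phi> y" "\<And>y. \<phi> y \<le> B"
    and supp: "\<And>y. K < \<bar>y\<bar> \<Longrightarrow> \<phi> y = 0" and "0 < \<delta>" "0 < K"
    and uc: "\<And>y z. \<bar>y - z\<bar> \<le> \<delta> \<Longrightarrow> \<bar>\<phi> y - \<phi> z\<bar> \<le> \<eta>"
    and ab: "a \<le> b" and e: "e \<le> 1 / 2"
    and spacing: "\<bar>real n * (\<integral>t. indicator {a<..b} t * f t \<partial>lborel) - real m\<bar> \<le> e * real m"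
  defines "s \<equiv> real m / (real n + 1) * inverse (b - a)"
  shows "\<bar>s - f a\<bar> \<le> 2 * B * (1 / real n + e)
       + 2 * real n * B / real m * (\<integral>t. indicator {a<..b} t * \<bar>f t - \<phi> t\<bar> \<partial>lborel)
       + (\<eta> + B / \<delta> * (\<integral>t. indicator {a<..b} t * indicator {-(K + \<delta>)..K + \<delta>} t \<partial>lborel))
       + \<bar>f a - \<phi> a\<bar>"
proof -
  define p where "p = (\<integral>t. indicator {a<..b} t * f t \<partial>lborel)"
  define q where "q = (\<integral>t. indicator {a<..b} t * \<phi> t \<partial>lborel)"
  have [measurable]: "f \<in> borel_measurable borel" "\<phi> \<in> borel_measurable borel"
    using f(1) \<phi>(1) by (auto dest: borel_measurable_integrable)
  have B0: "0 \<le> B" using \<phi>(2,3)[of 0] by simp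
  have e0: "0 \<le> e"
  proof -
    have "0 \<le> e * real m" using spacing by linarith
    then show ?thesis using m by (simp add: zero_le_mult_iff)
  qed
  have int: "integrable lborel (\<lambda>t. indicator {a<..b} t * g t)" if "integrable lborel g" for g :: "real \<Rightarrow> real"
    using integrable_mult_indicator[of "{a<..b}" lborel g] that by simp
  have pm: "\<bar>real n * p - real m\<bar> \<le> e * real m" using spacing by (simp add: p_def)
  have ab': "a < b" and invL: "1 / (b - a) \<le> 2 * real n * B / real m"
    using spacing_estimate_bounded[OF n m f ab e spacing] by auto
  have 1: "\<bar>s - p / (b - a)\<bar> \<le> 2 * B * (1 / real n + e)"
  proof -
    have "\<bar>real m / (real n + 1) - p\<bar> \<le> \<bar>real m / (real n + 1) - real m / real n\<bar> + \<bar>p - real m / real n\<bar>"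
      by linarith
    also have "\<bar>real m / (real n + 1) - real m / real n\<bar> \<le> real m / real n * (1 / real n)"
    proof -
      have "real m / (real n + 1) - real m / real n = - (real m / real n * (1 / (real n + 1)))"
        using n by (simp add: field_simps)
      also have "\<bar>\<dots>\<bar> = real m / real n * (1 / (real n + 1))" by simp
      also have "\<dots> \<le> real m / real n * (1 / real n)"
        using n by (intro mult_left_mono divide_left_mono) auto
      finally show ?thesis .
    qed
    also have "\<bar>p - real m / real n\<bar> \<le> real m / real n * e"
    proof -
      have "p - real m / real n = (real n * p - real m) / real n" using n by (simp add: field_simps)
      also have "\<bar>\<dots>\<bar> = \<bar>real n * p - real m\<bar> / real n" by simp
      also have "\<dots> \<le> e * real m / real n" using pm by (intro divide_right_mono) auto
      finally show ?thesis by (simp add: mult.commute)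
    qed
    finally have "\<bar>real m / (real n + 1) - p\<bar> \<le> real m / real n * (1 / real n + e)"
      by (simp add: algebra_simps)
    then have "\<bar>real m / (real n + 1) - p\<bar> * (1 / (b - a))
        \<le> (real m / real n * (1 / real n + e)) * (2 * real n * B / real m)"
      using invL ab' e0 by (intro mult_mono) auto
    moreover have "s - p / (b - a) = (real m / (real n + 1) - p) * (1 / (b - a))"
      by (simp add: s_def inverse_eq_divide diff_divide_distrib)
    moreover have "(real m / real n * (1 / real n + e)) * (2 * real n * B / real m) = 2 * B * (1 / real n + e)"
      using n m by simp
    ultimately show ?thesis using ab' by (simp only: abs_mult) simp
  qed
  have 2: "\<bar>p / (b - a) - q / (b - a)\<bar>
    \<le> 2 * real n * B / real m * (\<integral>t. indicator {a<..b} t * \<bar>f t - \<phi> t\<bar> \<partial>lborel)"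
  proof -
    have "p - q = (\<integral>t. indicator {a<..b} t * (f t - \<phi> t) \<partial>lborel)"
      unfolding p_def q_def right_diff_distrib
      by (rule Bochner_Integration.integral_diff[symmetric]) (intro int f \<phi>)+
    also have "\<bar>\<dots>\<bar> \<le> (\<integral>t. \<bar>indicator {a<..b} t * (f t - \<phi> t)\<bar> \<partial>lborel)"
      by (rule integral_abs_bound)
    also have "\<dots> = (\<integral>t. indicator {a<..b} t * \<bar>f t - \<phi> t\<bar> \<partial>lborel)"
      by (simp add: abs_mult)
    finally have pq: "\<bar>p - q\<bar> \<le> (\<integral>t. indicator {a<..b} t * \<bar>f t - \<phi> t\<bar> \<partial>lborel)" .
    have "\<bar>p / (b - a) - q / (b - a)\<bar> = 1 / (b - a) * \<bar>p - q\<bar>"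
      using ab' by (simp add: abs_divide flip: diff_divide_distrib)
    also have "\<dots> \<le> 2 * real n * B / real m * (\<integral>t. indicator {a<..b} t * \<bar>f t - \<phi> t\<bar> \<partial>lborel)"
      using invL pq B0 by (intro mult_mono) auto
    finally show ?thesis .
  qed
  have 3: "\<bar>q / (b - a) - \<phi> a\<bar> \<le> \<eta> + B / \<delta> * (\<integral>t. indicator {a<..b} t * indicator {-(K + \<delta>)..K + \<delta>} t \<partial>lborel)"
    unfolding q_def by (rule average_near_left_endpoint) (use ab' \<phi> supp uc \<open>0 < \<delta>\<close> \<open>0 < K\<close> in auto)
  show "\<bar>s - f a\<bar> \<le> 2 * B * (1 / real n + e)
       + 2 * real n * B / real m * (\<integral>t. indicator {a<..b} t * \<bar>f t - \<phi> t\<bar> \<partial>lborel)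
       + (\<eta> + B / \<delta> * (\<integral>t. indicator {a<..b} t * indicator {-(K + \<delta>)..K + \<delta>} t \<partial>lborel))
       + \<bar>f a - \<phi> a\<bar>"
    using 1 2 3 by linarith
qed

lemma sum_spacing_estimate_error:
  fixes f \<phi> :: "real \<Rightarrow> real" and x :: "nat \<Rightarrow> real"
  assumes n: "1 \<le> n" and m: "1 \<le> m"
    and mono: "\<And>j k. 1 \<le> j \<Longrightarrow> j \<le> k \<Longrightarrow> k \<le> n \<Longrightarrow> x j \<le> x k"
    and f: "integrable lborel f" "\<And>y. f y \<le> B"
    and \<phi>: "integrable lborel \<phi>" "\<And>y. 0 \<le> \<phi> y" "\<And>y. \<phi> y \<le> B"
    and supp: "\<And>y. K < \<bar>y\<bar> \<Longrightarrow> \<phi> y = 0" and \<delta>: "0 < \<delta>" "0 < K"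
    and uc: "\<And>y z. \<bar>y - z\<bar> \<le> \<delta> \<Longrightarrow> \<bar>\<phi> y - \<phi> z\<bar> \<le> \<eta>"
    and e: "0 \<le> e" "e \<le> 1 / 2"
    and spacing: "\<And>j. j \<in> {1..n - m} \<Longrightarrow>
      \<bar>real n * (\<integral>t. indicator {x j<..x (j + m)} t * f t \<partial>lborel) - real m\<bar> \<le> e * real m"
  shows "(\<Sum>j=1..n - m. \<bar>real m / (real n + 1) * inverse (x (j + m) - x j) - f (x j)\<bar>) / real n
    \<le> 2 * B * (1 / real n + e) + 2 * B * (\<integral>t. \<bar>f t - \<phi> t\<bar> \<partial>lborel)
      + \<eta> + B / \<delta> * (2 * (K + \<delta>)) * (real m / real n) + (\<Sum>j=1..n. \<bar>f (x j) - \<phi> (x j)\<bar>) / real n"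
proof -
  have B0: "0 \<le> B" using \<phi>(2,3)[of 0] by simp
  have \<eta>0: "0 \<le> \<eta>" using uc[of 0 0] \<delta> by simp
  have mono': "x j \<le> x (j + m)" if "j \<in> {1..n - m}" for j using that by (intro mono) auto
  define c where "c = 2 * B * (1 / real n + e) + \<eta>"
  define I1 where "I1 j = (\<integral>t. indicator {x j<..x (j + m)} t * \<bar>f t - \<phi> t\<bar> \<partial>lborel)" for j
  define I2 where "I2 j = (\<integral>t. indicator {x j<..x (j + m)} t * indicator {-(K + \<delta>)..K + \<delta>} t \<partial>lborel :: real)" for j
  have "(\<Sum>j=1..n - m. \<bar>real m / (real n + 1) * inverse (x (j + m) - x j) - f (x j)\<bar>)
      \<le> (\<Sum>j=1..n - m. c + 2 * real n * B / real m * I1 j + B / \<delta> * I2 j + \<bar>f (x j) - \<phi> (x j)\<bar>)"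
  proof (rule sum_mono)
    fix j assume j: "j \<in> {1..n - m}"
    show "\<bar>real m / (real n + 1) * inverse (x (j + m) - x j) - f (x j)\<bar>
      \<le> c + 2 * real n * B / real m * I1 j + B / \<delta> * I2 j + \<bar>f (x j) - \<phi> (x j)\<bar>"
      using spacing_estimate_error[OF n m f \<phi> supp \<delta> uc mono'[OF j] e(2) spacing[OF j]]
      unfolding c_def I1_def I2_def by linarith
  qed
  also have "\<dots> = real (n - m) * c + 2 * real n * B / real m * (\<Sum>j=1..n - m. I1 j)
      + B / \<delta> * (\<Sum>j=1..n - m. I2 j) + (\<Sum>j=1..n - m. \<bar>f (x j) - \<phi> (x j)\<bar>)"
    by (simp add: sum.distrib sum_distrib_left)
  also have "\<dots> \<le> real n * c + 2 * real n * B / real m * (real m * (\<integral>t. \<bar>f t - \<phi> t\<bar> \<partial>lborel))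
      + B / \<delta> * (real m * (2 * (K + \<delta>))) + (\<Sum>j=1..n. \<bar>f (x j) - \<phi> (x j)\<bar>)"
  proof (intro add_mono mult_left_mono mult_right_mono)
    show "(\<Sum>j=1..n - m. I1 j) \<le> real m * (\<integral>t. \<bar>f t - \<phi> t\<bar> \<partial>lborel)"
      unfolding I1_def using f \<phi> by (intro sum_integrals_over_spacings mono) auto
    have "(\<Sum>j=1..n - m. I2 j) \<le> real m * (\<integral>t. indicator {-(K + \<delta>)..K + \<delta>} t \<partial>lborel)"
      unfolding I2_def using integrable_indicator_interval(2)[of "-(K + \<delta>)" "K + \<delta>" 1]
      by (intro sum_integrals_over_spacings mono) auto
    then show "(\<Sum>j=1..n - m. I2 j) \<le> real m * (2 * (K + \<delta>))" using \<delta> by simp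
    show "(\<Sum>j=1..n - m. \<bar>f (x j) - \<phi> (x j)\<bar>) \<le> (\<Sum>j=1..n. \<bar>f (x j) - \<phi> (x j)\<bar>)"
      by (intro sum_mono2) auto
  qed (use B0 \<eta>0 e \<delta> in \<open>auto simp: c_def\<close>)
  finally have "(\<Sum>j=1..n - m. \<bar>real m / (real n + 1) * inverse (x (j + m) - x j) - f (x j)\<bar>) / real n
     \<le> (real n * c + 2 * real n * B / real m * (real m * (\<integral>t. \<bar>f t - \<phi> t\<bar> \<partial>lborel))
      + B / \<delta> * (real m * (2 * (K + \<delta>))) + (\<Sum>j=1..n. \<bar>f (x j) - \<phi> (x j)\<bar>)) / real n"
    by (intro divide_right_mono) auto
  also have "\<dots> = c + 2 * B * (\<integral>t. \<bar>f t - \<phi> t\<bar> \<partial>lborel)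
      + B / \<delta> * (2 * (K + \<delta>)) * (real m / real n) + (\<Sum>j=1..n. \<bar>f (x j) - \<phi> (x j)\<bar>) / real n"
    using n m by (simp add: add_divide_distrib)
  finally show ?thesis unfolding c_def by linarith
qed

text \<open>The empirical term converges to a limit that is again of the order of the \<open>L\<^sup>1\<close> distance
between \<open>f\<close> and \<open>\<phi>\<close>. So \<open>\<phi>\<close> is chosen first, then \<open>\<delta>\<close> from the uniform
continuity of \<open>\<phi>\<close>, and only then \<open>n\<close> tends to infinity.\<close>

lemma mean_spacing_estimate_error_tendsto_0:
  fixes f :: "real \<Rightarrow> real" and x :: "nat \<Rightarrow> nat \<Rightarrow> real" and m :: "nat \<Rightarrow> nat"
  assumes m: "\<And>n. 1 \<le> n \<Longrightarrow> 1 \<le> m n" and m_over_n: "(\<lambda>n. real (m n) / real n) \<longlonglongrightarrow> 0"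
    and mono: "\<And>n j k. 1 \<le> j \<Longrightarrow> j \<le> k \<Longrightarrow> k \<le> n \<Longrightarrow> x n j \<le> x n k"
    and f: "integrable lborel f" "\<And>y. 0 \<le> f y" "\<And>y. f y \<le> B"
    and spacing: "\<And>\<epsilon>. 0 < \<epsilon> \<Longrightarrow> \<forall>\<^sub>F n in sequentially. \<forall>j\<in>{1..n - m n}.
      \<bar>real n * (\<integral>t. indicator {x n j<..x n (j + m n)} t * f t \<partial>lborel) - real (m n)\<bar> \<le> \<epsilon> * real (m n)"
    and approx: "\<And>r. 0 < r \<Longrightarrow> \<exists>\<phi> K c. continuous_on UNIV \<phi> \<and> integrable lborel \<phi> \<and>
      (\<forall>y. 0 \<le> \<phi> y \<and> \<phi> y \<le> B) \<and> 0 < K \<and> (\<forall>y. K < \<bar>y\<bar> \<longrightarrow> \<phi> y = 0) \<and>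
      (\<integral>t. \<bar>f t - \<phi> t\<bar> \<partial>lborel) < r \<and>
      (\<lambda>n. (\<Sum>j=1..n. \<bar>f (x n j) - \<phi> (x n j)\<bar>) / real n) \<longlonglongrightarrow> c \<and>
      c \<le> B * (\<integral>t. \<bar>f t - \<phi> t\<bar> \<partial>lborel)"
  shows "(\<lambda>n. (\<Sum>j=1..n - m n. \<bar>real (m n) / (real n + 1) * inverse (x n (j + m n) - x n j) - f (x n j)\<bar>) / real n)
    \<longlonglongrightarrow> 0" (is "?err \<longlonglongrightarrow> 0")
proof (rule tendstoI)
  fix r :: real assume r: "0 < r"
  have B0: "0 \<le> B" using f(2,3)[of 0] by simp
  have "0 < r / (8 * (B + 1))" using r B0 by simp
  from approx[OF this] obtain \<phi> K c where \<phi>c: "continuous_on UNIV \<phi>" and \<phi>i: "integrable lborel \<phi>"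
    and \<phi>: "\<And>y. 0 \<le> \<phi> y" "\<And>y. \<phi> y \<le> B" and K: "0 < K" and supp: "\<And>y. K < \<bar>y\<bar> \<Longrightarrow> \<phi> y = 0"
    and L1: "(\<integral>t. \<bar>f t - \<phi> t\<bar> \<partial>lborel) < r / (8 * (B + 1))"
    and emp: "(\<lambda>n. (\<Sum>j=1..n. \<bar>f (x n j) - \<phi> (x n j)\<bar>) / real n) \<longlonglongrightarrow> c"
    and c: "c \<le> B * (\<integral>t. \<bar>f t - \<phi> t\<bar> \<partial>lborel)" by blast
  have "0 < r / 8" using r by simp
  from uniformly_continuous_compact_support[OF \<phi>c supp this] obtain \<delta> where \<delta>: "0 < \<delta>"
    and uc: "\<And>y z. \<bar>y - z\<bar> \<le> \<delta> \<Longrightarrow> \<bar>\<phi> y - \<phi> z\<bar> \<le> r / 8" by blast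
  define e where "e = min (1 / 2) (r / (16 * (B + 1)))"
  have e: "0 < e" "e \<le> 1 / 2" "e \<le> r / (16 * (B + 1))"
    unfolding e_def using r B0 by (simp add: min_less_iff_conj, intro min.cobounded1, intro min.cobounded2)
  define bound where "bound n = 2 * B * (1 / real n + e) + 2 * B * (\<integral>t. \<bar>f t - \<phi> t\<bar> \<partial>lborel)
      + r / 8 + B / \<delta> * (2 * (K + \<delta>)) * (real (m n) / real n) + (\<Sum>j=1..n. \<bar>f (x n j) - \<phi> (x n j)\<bar>) / real n" for n
  have "bound \<longlonglongrightarrow> 2 * B * (0 + e) + 2 * B * (\<integral>t. \<bar>f t - \<phi> t\<bar> \<partial>lborel) + r / 8 + B / \<delta> * (2 * (K + \<delta>)) * 0 + c"
    unfolding bound_def by (intro tendsto_intros lim_1_over_n m_over_n emp)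
  moreover have "2 * B * (0 + e) + 2 * B * (\<integral>t. \<bar>f t - \<phi> t\<bar> \<partial>lborel) + r / 8 + B / \<delta> * (2 * (K + \<delta>)) * 0 + c < r"
  proof -
    have "B * (\<integral>t. \<bar>f t - \<phi> t\<bar> \<partial>lborel) \<le> B * (r / (8 * (B + 1)))"
      using L1 B0 by (intro mult_left_mono) auto
    also have "\<dots> \<le> r / 8" using r B0 by (simp add: field_simps)
    finally have 1: "B * (\<integral>t. \<bar>f t - \<phi> t\<bar> \<partial>lborel) \<le> r / 8" .
    have "B * e \<le> B * (r / (16 * (B + 1)))" using e B0 by (intro mult_left_mono) auto
    also have "\<dots> \<le> r / 16" using r B0 by (simp add: field_simps)
    finally have "B * e \<le> r / 16" .
    with 1 c r show ?thesis by simp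
  qed
  ultimately have "\<forall>\<^sub>F n in sequentially. bound n < r" by (rule order_tendstoD(2))
  then show "\<forall>\<^sub>F n in sequentially. dist (?err n) 0 < r"
    using spacing[OF e(1)] eventually_ge_at_top[of 1]
  proof eventually_elim
    case (elim n)
    have "?err n \<le> bound n"
      unfolding bound_def
      by (rule sum_spacing_estimate_error)
         (use elim m mono f \<phi> \<phi>i supp \<delta> K uc e in auto)
    moreover have "0 \<le> ?err n" by (intro divide_nonneg_nonneg sum_nonneg) auto
    ultimately show ?case using elim(1) by simp
  qed
qed

text \<open>The estimator averages over \<open>n - m\<close> ranks only. The missing \<open>m\<close> bounded terms and the
changed normalisation both disappear because \<open>m / n\<close> tends to \<open>0\<close>.\<close>

lemma truncated_mean_tendsto:
  fixes a b :: "nat \<Rightarrow> nat \<Rightarrow> real" and m :: "nat \<Rightarrow> nat"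
  assumes m: "\<And>n. 1 \<le> n \<Longrightarrow> m n \<le> n" and m_over_n: "(\<lambda>n. real (m n) / real n) \<longlonglongrightarrow> 0"
    and b: "\<And>n j. 0 \<le> b n j" "\<And>n j. b n j \<le> B"
    and close: "(\<lambda>n. (\<Sum>j=1..n - m n. \<bar>a n j - b n j\<bar>) / real n) \<longlonglongrightarrow> 0"
    and mean: "(\<lambda>n. (\<Sum>j=1..n. b n j) / real n) \<longlonglongrightarrow> \<mu>"
  shows "(\<lambda>n. 1 / real (n - m n) * (\<Sum>j=1..n - m n. a n j)) \<longlonglongrightarrow> \<mu>"
proof -
  define A where "A n = (\<Sum>j=1..n - m n. a n j) / real n" for n
  have "(\<lambda>n. A n - (\<Sum>j=1..n. b n j) / real n) \<longlonglongrightarrow> 0"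
  proof (rule tendsto_0_le)
    show "(\<lambda>n. (\<Sum>j=1..n - m n. \<bar>a n j - b n j\<bar>) / real n + B * (real (m n) / real n)) \<longlonglongrightarrow> 0"
      using tendsto_add[OF close tendsto_mult_left[OF m_over_n, of B]] by simp
    show "\<forall>\<^sub>F n in sequentially. norm (A n - (\<Sum>j=1..n. b n j) / real n)
      \<le> norm ((\<Sum>j=1..n - m n. \<bar>a n j - b n j\<bar>) / real n + B * (real (m n) / real n)) * 1"
      using eventually_ge_at_top[of 1]
    proof eventually_elim
      case (elim n)
      have "(\<Sum>j=1..n. b n j) = (\<Sum>j=1..n - m n. b n j) + (\<Sum>j=n - m n + 1..n. b n j)"
        using sum.ub_add_nat[of 1 "n - m n" "b n" "m n"] m[OF elim] by simp
      then have "A n - (\<Sum>j=1..n. b n j) / real n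
        = ((\<Sum>j=1..n - m n. a n j - b n j) - (\<Sum>j=n - m n + 1..n. b n j)) / real n"
        by (simp add: A_def sum_subtractf diff_divide_distrib add_divide_distrib)
      also have "\<bar>\<dots>\<bar> \<le> ((\<Sum>j=1..n - m n. \<bar>a n j - b n j\<bar>) + B * real (m n)) / real n"
      proof -
        have "\<bar>\<Sum>j=1..n - m n. a n j - b n j\<bar> \<le> (\<Sum>j=1..n - m n. \<bar>a n j - b n j\<bar>)" by (rule sum_abs)
        moreover have "0 \<le> (\<Sum>j=n - m n + 1..n. b n j)" by (intro sum_nonneg b)
        moreover have "(\<Sum>j=n - m n + 1..n. b n j) \<le> B * real (m n)"
          using sum_bounded_above[of "{n - m n + 1..n}" "b n" B] b m[OF elim] by (simp add: mult.commute)
        ultimately have "\<bar>(\<Sum>j=1..n - m n. a n j - b n j) - (\<Sum>j=n - m n + 1..n. b n j)\<bar>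
          \<le> (\<Sum>j=1..n - m n. \<bar>a n j - b n j\<bar>) + B * real (m n)" by linarith
        then show ?thesis by (simp only: abs_divide abs_of_nat divide_right_mono of_nat_0_le_iff)
      qed
      finally show ?case by (simp add: add_divide_distrib)
    qed
  qed
  from tendsto_add[OF this mean] have "A \<longlonglongrightarrow> \<mu>" by simp
  moreover have "(\<lambda>n. 1 - real (m n) / real n) \<longlonglongrightarrow> 1"
    using tendsto_diff[OF tendsto_const m_over_n] by simp
  ultimately have lim: "(\<lambda>n. A n / (1 - real (m n) / real n)) \<longlonglongrightarrow> \<mu>"
    using tendsto_divide by fastforce
  have "\<forall>\<^sub>F n in sequentially. A n / (1 - real (m n) / real n) = 1 / real (n - m n) * (\<Sum>j=1..n - m n. a n j)"
    using eventually_ge_at_top[of 1]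
  proof eventually_elim
    case (elim n)
    have "1 - real (m n) / real n = real (n - m n) / real n"
      using m[OF elim] elim by (simp add: of_nat_diff field_simps)
    then show ?case using elim by (simp add: A_def)
  qed
  with lim show ?thesis by (rule Lim_transform_eventually)
qed

section \<open>Consistency of the spacing estimator of varextropy\<close>

theorem theorem2p1:
  fixes M :: "'a measure"
    and X :: "'a \<Rightarrow> real"
    and Xs :: "nat \<Rightarrow> 'a \<Rightarrow> real"
    and f :: "real \<Rightarrow> real"
    and m :: "nat \<Rightarrow> nat"
  assumes "prob_space M"
    and X_nonneg: "AE \<omega> in M. 0 \<le> X \<omega>"
    and f_nonneg: "\<And>x. 0 \<le> f x"
    and X_density: "distributed M lborel X (\<lambda>x. ennreal (f x))"
    and Xs_indep: "prob_space.indep_vars M (\<lambda>_. borel) Xs {1..}"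
    and Xs_copies: "\<And>i. 1 \<le> i \<Longrightarrow> distr M borel (Xs i) = distr M borel X"
    and f_bounded: "bounded (range f)"
    and m_range: "\<And>n. 1 \<le> n \<Longrightarrow> 1 \<le> m n \<and> m n \<le> n"
    and m_infinity: "filterlim m at_top sequentially"
    and m_log: "filterlim (\<lambda>n. real (m n) / ln (real n)) at_top sequentially"
    and m_over_n: "(\<lambda>n. real (m n) / real n) \<longlonglongrightarrow> 0"
  shows "AE \<omega> in M. (\<lambda>n. VJV (m n) n (\<lambda>i. Xs i \<omega>)) \<longlonglongrightarrow> varextropy M X f"
proof -
  interpret prob_space M by fact
  define D where "D = distr M borel X"
  interpret iid_sample M Xs D
    using Xs_indep Xs_copies by unfold_locales (auto simp: D_def)
  interpret D: real_distribution D by (rule real_distribution_D)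
  have fm [measurable]: "f \<in> borel_measurable borel"
    using distributed_real_measurable[OF _ X_density] f_nonneg by simp
  have Xm [measurable]: "X \<in> borel_measurable M"
    using distributed_measurable[OF X_density] by simp
  have D_eq: "D = density lborel (\<lambda>x. ennreal (f x))"
    unfolding D_def using distributed_distr_eq_density[OF X_density]
    by (metis distr_cong sets_lborel)
  have int_D: "(\<integral>x. h x \<partial>D) = (\<integral>x. f x * h x \<partial>lborel)" if [measurable]: "h \<in> borel_measurable borel" for h
    unfolding D_eq using f_nonneg by (intro integral_real_density) auto
  obtain B where B: "\<And>x. f x \<le> B"
    using f_bounded by (auto simp: bounded_iff) (meson abs_le_D1)
  have B0: "0 \<le> B" using f_nonneg[of 0] B[of 0] by simp
  have fi: "integrable lborel f"
    using integrable_real_density[of f lborel "\<lambda>_. 1"] f_nonneg D.integrable_const[of "1::real"]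
    unfolding D_eq by simp
  have atomless: "measure D {x} = 0" for x
  proof -
    have "measure D {x} = (\<integral>t. f t * indicator {x} t \<partial>lborel)"
      using int_D[of "indicator {x}"] by simp
    also have "\<dots> = (\<integral>t. 0 \<partial>(lborel :: real measure))"
      by (intro integral_cong_AE) (use AE_lborel_singleton[of x] in \<open>auto simp: indicator_def\<close>)
    finally show ?thesis by simp
  qed
  have cdf_diff: "cdf D b - cdf D a = (\<integral>t. indicator {a<..b} t * f t \<partial>lborel)" if "a \<le> b" for a b
  proof -
    have "cdf D b - cdf D a = measure D {a<..b}"
      using that by (cases "a = b") (auto simp: D.cdf_diff_eq)
    also have "\<dots> = (\<integral>t. indicator {a<..b} t * f t \<partial>lborel)"
      using int_D[of "indicator {a<..b}"] by (simp add: mult.commute)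
    finally show ?thesis .
  qed
  define approximates where "approximates \<phi> K r \<longleftrightarrow> continuous_on UNIV \<phi> \<and> integrable lborel \<phi> \<and>
      (\<forall>y. 0 \<le> \<phi> y \<and> \<phi> y \<le> B) \<and> 0 < K \<and> (\<forall>y. K < \<bar>y\<bar> \<longrightarrow> \<phi> y = 0) \<and>
      (\<integral>t. \<bar>f t - \<phi> t\<bar> \<partial>lborel) < r" for \<phi> :: "real \<Rightarrow> real" and K r :: real
  have "\<exists>\<phi> K. approximates \<phi> K (1 / real (Suc i))" for i
  proof -
    have "0 < 1 / real (Suc i)" by simp
    show ?thesis
    proof (rule L1_approx_continuous_compact_support[OF fi f_nonneg B \<open>0 < 1 / real (Suc i)\<close>])
      fix \<psi> L assume "continuous_on UNIV \<psi>" "\<And>y. 0 \<le> \<psi> y" "\<And>y. \<psi> y \<le> B"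
        "0 < L" "\<And>y. L < \<bar>y\<bar> \<Longrightarrow> \<psi> y = 0" "integrable lborel \<psi>"
        "(\<integral>t. \<bar>f t - \<psi> t\<bar> \<partial>lborel) < 1 / real (Suc i)"
      then show ?thesis unfolding approximates_def by (intro exI[of _ \<psi>] exI[of _ L]) simp
    qed
  qed
  then obtain \<phi> K where "\<And>i. approximates (\<phi> i) (K i) (1 / real (Suc i))" by metis
  then have \<phi>: "\<And>i. continuous_on UNIV (\<phi> i)" "\<And>i. integrable lborel (\<phi> i)"
      "\<And>i y. 0 \<le> \<phi> i y" "\<And>i y. \<phi> i y \<le> B" "\<And>i. 0 < K i" "\<And>i y. K i < \<bar>y\<bar> \<Longrightarrow> \<phi> i y = 0"
      "\<And>i. (\<integral>t. \<bar>f t - \<phi> i t\<bar> \<partial>lborel) < 1 / real (Suc i)"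
    unfolding approximates_def by blast+
  have [measurable]: "\<phi> i \<in> borel_measurable borel" for i
    using \<phi>(1) by (rule borel_measurable_continuous_onI)
  have f\<phi>: "\<bar>f y - \<phi> i y\<bar> \<le> B" for i y
    using f_nonneg[of y] B[of y] \<phi>(3,4)[of i y] by linarith
  have approx_emp: "(\<integral>t. \<bar>f t - \<phi> i t\<bar> \<partial>D) \<le> B * (\<integral>t. \<bar>f t - \<phi> i t\<bar> \<partial>lborel)" for i
  proof -
    have int: "integrable lborel (\<lambda>t. \<bar>f t - \<phi> i t\<bar>)" using fi \<phi>(2) by auto
    have "(\<integral>t. \<bar>f t - \<phi> i t\<bar> \<partial>D) = (\<integral>t. f t * \<bar>f t - \<phi> i t\<bar> \<partial>lborel)" by (rule int_D) simp
    also have "\<dots> \<le> (\<integral>t. B * \<bar>f t - \<phi> i t\<bar> \<partial>lborel)"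
    proof (rule integral_mono)
      show "integrable lborel (\<lambda>t. f t * \<bar>f t - \<phi> i t\<bar>)"
        by (rule Bochner_Integration.integrable_bound[OF integrable_mult_right[OF int, of B]])
           (use f_nonneg B B0 in \<open>auto simp: abs_mult intro!: AE_I2 mult_right_mono\<close>)
    qed (use int B in \<open>auto intro: mult_right_mono\<close>)
    finally show ?thesis by simp
  qed
  have f2: "(f y)\<^sup>2 \<le> B\<^sup>2" for y using f_nonneg B by (intro power_mono)
  \<comment> \<open>A null set is removed for each function; hence the approximations form a sequence fixed in advance.\<close>
  have "AE \<omega> in M. \<forall>i. (\<lambda>n. (\<Sum>j=1..n. \<bar>f (Xs j \<omega>) - \<phi> i (Xs j \<omega>)\<bar>) / real n)
      \<longlonglongrightarrow> (\<integral>t. \<bar>f t - \<phi> i t\<bar> \<partial>D)"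
    unfolding AE_all_countable using f\<phi> by (intro allI strong_law_bounded[where B=B]) auto
  moreover have "AE \<omega> in M. (\<lambda>n. (\<Sum>j=1..n. f (Xs j \<omega>)) / real n) \<longlonglongrightarrow> (\<integral>t. f t \<partial>D)"
    by (intro strong_law_bounded[where B=B] fm f_nonneg B)
  moreover have "AE \<omega> in M. (\<lambda>n. (\<Sum>j=1..n. (f (Xs j \<omega>))\<^sup>2) / real n) \<longlonglongrightarrow> (\<integral>t. (f t)\<^sup>2 \<partial>D)"
    by (rule strong_law_bounded[where B="B\<^sup>2"]) (use f2 in auto)
  moreover have "AE \<omega> in M. \<forall>\<epsilon>>0. \<forall>\<^sub>F n in sequentially. \<forall>j\<in>{1..n - m n}.
    \<bar>real n * (cdf D (order_stat n (\<lambda>i. Xs i \<omega>) (j + m n)) - cdf D (order_stat n (\<lambda>i. Xs i \<omega>) j)) - real (m n)\<bar>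
      \<le> \<epsilon> * real (m n)"
    using m_range m_infinity m_log by (intro AE_uniform_cdf_spacing atomless) auto
  ultimately have "AE \<omega> in M. (\<lambda>n. VJV (m n) n (\<lambda>i. Xs i \<omega>)) \<longlonglongrightarrow>
    1 / 4 * ((\<integral>t. (f t)\<^sup>2 \<partial>D) - (\<integral>t. f t \<partial>D)\<^sup>2)"
  proof eventually_elim
    case (elim \<omega>)
    define x where "x n = order_stat n (\<lambda>i. Xs i \<omega>)" for n
    define s where "s n = spacing_density (m n) n (\<lambda>i. Xs i \<omega>)" for n
    have s_eq: "s n j = real (m n) / (real n + 1) * inverse (x n (j + m n) - x n j)" for n j
      by (simp add: s_def x_def spacing_density_def)
    have mono: "x n j \<le> x n k" if "1 \<le> j" "j \<le> k" "k \<le> n" for n j k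
      unfolding x_def using that by (rule order_stat_mono)
    have mono': "x n j \<le> x n (j + m n)" if "j \<in> {1..n - m n}" for n j
      using that by (intro mono) auto
    have spacing: "\<forall>\<^sub>F n in sequentially. \<forall>j\<in>{1..n - m n}.
      \<bar>real n * (\<integral>t. indicator {x n j<..x n (j + m n)} t * f t \<partial>lborel) - real (m n)\<bar> \<le> \<epsilon> * real (m n)"
      if "0 < \<epsilon>" for \<epsilon>
      using elim(4)[rule_format, OF that]
      by eventually_elim (use mono' cdf_diff in \<open>simp add: x_def\<close>)
    have err: "(\<lambda>n. (\<Sum>j=1..n - m n. \<bar>s n j - f (x n j)\<bar>) / real n) \<longlonglongrightarrow> 0"
      unfolding s_eq
    proof (rule mean_spacing_estimate_error_tendsto_0[OF _ m_over_n mono fi f_nonneg B spacing])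
      fix r :: real assume "0 < r"
      then obtain i where "1 / real (Suc i) < r" using nat_approx_posE by blast
      then have "(\<integral>t. \<bar>f t - \<phi> i t\<bar> \<partial>lborel) < r" using \<phi>(7)[of i] by linarith
      moreover have "(\<lambda>n. (\<Sum>j=1..n. \<bar>f (x n j) - \<phi> i (x n j)\<bar>) / real n) \<longlonglongrightarrow> (\<integral>t. \<bar>f t - \<phi> i t\<bar> \<partial>D)"
        using elim(1) unfolding x_def sum_order_stat[of "\<lambda>y. \<bar>f y - \<phi> i y\<bar>"] by blast
      ultimately show "\<exists>\<phi> K c. continuous_on UNIV \<phi> \<and> integrable lborel \<phi> \<and>
        (\<forall>y. 0 \<le> \<phi> y \<and> \<phi> y \<le> B) \<and> 0 < K \<and> (\<forall>y. K < \<bar>y\<bar> \<longrightarrow> \<phi> y = 0) \<and>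
        (\<integral>t. \<bar>f t - \<phi> t\<bar> \<partial>lborel) < r \<and>
        (\<lambda>n. (\<Sum>j=1..n. \<bar>f (x n j) - \<phi> (x n j)\<bar>) / real n) \<longlonglongrightarrow> c \<and>
        c \<le> B * (\<integral>t. \<bar>f t - \<phi> t\<bar> \<partial>lborel)"
        using \<phi> approx_emp[of i] by blast
    qed (use m_range in auto)
    \<comment> \<open>Both \<open>s\<close> and \<open>f\<close> are bounded, so squaring is Lipschitz on the relevant range.\<close>
    have err2: "(\<lambda>n. (\<Sum>j=1..n - m n. \<bar>(s n j)\<^sup>2 - (f (x n j))\<^sup>2\<bar>) / real n) \<longlonglongrightarrow> 0"
    proof (rule tendsto_0_le[OF err])
      have "0 < (1 / 2 :: real)" by simp
      from spacing[OF this]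
      show "\<forall>\<^sub>F n in sequentially. norm ((\<Sum>j=1..n - m n. \<bar>(s n j)\<^sup>2 - (f (x n j))\<^sup>2\<bar>) / real n)
        \<le> norm ((\<Sum>j=1..n - m n. \<bar>s n j - f (x n j)\<bar>) / real n) * (3 * B)"
        using eventually_ge_at_top[of 1]
      proof eventually_elim
        case (elim n)
        have "(\<Sum>j=1..n - m n. \<bar>(s n j)\<^sup>2 - (f (x n j))\<^sup>2\<bar>) \<le> (\<Sum>j=1..n - m n. \<bar>s n j - f (x n j)\<bar> * (3 * B))"
        proof (rule sum_mono)
          fix j assume j: "j \<in> {1..n - m n}"
          have "s n j \<le> 2 * B" unfolding s_eq
            using m_range[OF elim(2)]
            by (intro spacing_estimate_bounded(3)[OF elim(2) _ fi B mono'[OF j] order_refl bspec[OF elim(1) j]]) simp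
          moreover have "0 \<le> s n j" unfolding s_eq using mono'[OF j] by simp
          ultimately have "\<bar>s n j + f (x n j)\<bar> \<le> 3 * B"
            using f_nonneg[of "x n j"] B[of "x n j"] by simp
          then have "\<bar>s n j - f (x n j)\<bar> * \<bar>s n j + f (x n j)\<bar> \<le> \<bar>s n j - f (x n j)\<bar> * (3 * B)"
            by (intro mult_left_mono) auto
          then show "\<bar>(s n j)\<^sup>2 - (f (x n j))\<^sup>2\<bar> \<le> \<bar>s n j - f (x n j)\<bar> * (3 * B)"
            by (simp add: power2_eq_square square_diff_square_factored abs_mult mult.commute)
        qed
        then have "(\<Sum>j=1..n - m n. \<bar>(s n j)\<^sup>2 - (f (x n j))\<^sup>2\<bar>) / real n
            \<le> (\<Sum>j=1..n - m n. \<bar>s n j - f (x n j)\<bar>) / real n * (3 * B)"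
          by (simp add: divide_right_mono flip: sum_distrib_right)
        then show ?case by (simp add: sum_nonneg)
      qed
    qed
    have "(\<lambda>n. (\<Sum>j=1..n. f (x n j)) / real n) \<longlonglongrightarrow> (\<integral>t. f t \<partial>D)"
      using elim(2) unfolding x_def sum_order_stat .
    then have "(\<lambda>n. T2 (m n) n (\<lambda>i. Xs i \<omega>)) \<longlonglongrightarrow> (\<integral>t. f t \<partial>D)"
      unfolding T2_def s_def[symmetric]
      by (intro truncated_mean_tendsto[OF _ m_over_n f_nonneg B err]) (use m_range in auto)
    moreover have "(\<lambda>n. (\<Sum>j=1..n. (f (x n j))\<^sup>2) / real n) \<longlonglongrightarrow> (\<integral>t. (f t)\<^sup>2 \<partial>D)"
      using elim(3) unfolding x_def sum_order_stat[of "\<lambda>y. (f y)\<^sup>2"] .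
    then have "(\<lambda>n. T1 (m n) n (\<lambda>i. Xs i \<omega>)) \<longlonglongrightarrow> (\<integral>t. (f t)\<^sup>2 \<partial>D)"
      unfolding T1_def s_def[symmetric]
      by (intro truncated_mean_tendsto[OF _ m_over_n _ f2 err2]) (use m_range in auto)
    ultimately show ?case unfolding VJV_def by (intro tendsto_intros)
  qed
  moreover have "varextropy M X f = 1 / 4 * ((\<integral>t. (f t)\<^sup>2 \<partial>D) - (\<integral>t. f t \<partial>D)\<^sup>2)"
  proof -
    have int1: "integrable M (\<lambda>\<omega>. f (X \<omega>))"
      using f_nonneg B by (intro integrable_const_bound[where B=B]) auto
    have int2: "integrable M (\<lambda>\<omega>. (f (X \<omega>))\<^sup>2)"
      using f2 by (intro integrable_const_bound[where B="B\<^sup>2"]) auto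
    have "varextropy M X f = expectation (\<lambda>\<omega>. (- (1 / 2) * f (X \<omega>))\<^sup>2) - (expectation (\<lambda>\<omega>. - (1 / 2) * f (X \<omega>)))\<^sup>2"
      unfolding varextropy_def using int1 int2 by (intro variance_eq) (auto simp: power_divide)
    also have "\<dots> = 1 / 4 * (expectation (\<lambda>\<omega>. (f (X \<omega>))\<^sup>2) - (expectation (\<lambda>\<omega>. f (X \<omega>)))\<^sup>2)"
      by (simp add: power_divide)
    also have "expectation (\<lambda>\<omega>. (f (X \<omega>))\<^sup>2) = (\<integral>t. (f t)\<^sup>2 \<partial>D)"
      unfolding D_def by (rule integral_distr[symmetric]) auto
    also have "expectation (\<lambda>\<omega>. f (X \<omega>)) = (\<integral>t. f t \<partial>D)"
      unfolding D_def by (rule integral_distr[symmetric]) auto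
    finally show ?thesis .
  qed
  ultimately show ?thesis by (simp only:)
qed

end
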